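(* Let $K$ be a field, $S=K[x_1,\ldots,x_n]$, and let $I\subset S$ be a matroidal ideal generated in degree $d\ge 1$ such that $\gcd(I)=1$ and $\operatorname{Supp}(I)=\{x_1,\ldots,x_n\}$. Then the depth function of $I$ is constant if and only if $I=P_1\cdots P_d$, where $P_1,\ldots,P_d$ are monomial prime ideals in pairwise disjoint sets of variables.
   Context: For a monomial ideal $I$, $G(I)$ denotes its unique minimal set of monomial generators. A nonzero squarefree monomial ideal $I\subset S$ generated in a single degree is called matroidal if the following exchange property holds: for any $u,v\in G(I)$ and all $i$ such that $x_i\mid u$ and $x_i\nmid v$, there exists $j\neq i$ such that $x_j\mid v$, $x_j\nmid u$ and $(u/x_i)x_j\in G(I)$. If $G(I)=\{u_1,\ldots,u_m\}$, then $\operatorname{Supp}(I)$ is the set of variables dividing at least one $u_i$, and $\gcd(I)=\gcd(u_1,\ldots,u_m)$. A monomial prime ideal is an ideal generated by a set of variables. The depth function of a proper graded ideal $L\subset S$ is $k\mapsto \operatorname{depth} S/L^k$ for integers $k\ge 1$; it is constant if $\operatorname{depth} S/L^k=\operatorname{depth} S/L$ for all $k\ge 1$. *)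

theory Defs
  imports
    "HOL-Library.Poly_Mapping"
    "HOL-Library.Extended_Nat"
    "HOL-Library.Disjoint_Sets"
    "HOL-Computational_Algebra.Squarefree"
begin

section \<open>The polynomial ring\<close>

text \<open>
  The ring \<open>K[x\<^sub>1,\<dots>,x\<^sub>n]\<close> is the type \<open>('n, 'k) mpoly\<close>, with the variables indexed by a finite
  type \<open>'n\<close> (so \<open>n = CARD('n)\<close>). A power product is given by its exponent vector, a finitely
  supported function of type \<open>'n \<Rightarrow>\<^sub>0 nat\<close>.
\<close>

type_synonym ('n, 'k) mpoly = "('n \<Rightarrow>\<^sub>0 nat) \<Rightarrow>\<^sub>0 'k"

definition mon :: "('n \<Rightarrow>\<^sub>0 nat) \<Rightarrow> ('n, 'k::field) mpoly" where
  "mon m = Poly_Mapping.single m 1"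

definition Var :: "'n \<Rightarrow> ('n, 'k::field) mpoly" where
  "Var i = mon (Poly_Mapping.single i 1)"

definition exp_degree :: "('n::finite \<Rightarrow>\<^sub>0 nat) \<Rightarrow> nat" where
  "exp_degree m = (\<Sum>i\<in>UNIV. Poly_Mapping.lookup m i)"

section \<open>Ideals\<close>

text \<open>
  A commutative ring is a module over itself; its submodules are the ideals. The interpretation
  yields \<open>ideal.subspace I\<close> for \<open>I\<close> being an ideal and \<open>ideal.span A\<close> for the ideal generated
  by \<open>A\<close>.
\<close>

interpretation ideal: module "(*) :: 'a::comm_ring_1 \<Rightarrow> 'a \<Rightarrow> 'a"
  by standard (simp_all add: algebra_simps)

declare ideal.scale_scale [simp del] \<comment> \<open>loops with \<open>mult.assoc\<close>\<close>

text \<open>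
  The product of finitely many ideals is generated by the products with one factor from each
  of them. The empty product is the unit ideal.
\<close>

definition prod_ideals :: "('i \<Rightarrow> 'a::comm_ring_1 set) \<Rightarrow> 'i set \<Rightarrow> 'a set" where
  "prod_ideals P F = ideal.span {\<Prod>i\<in>F. f i | f. \<forall>i\<in>F. f i \<in> P i}"

definition power_ideal :: "'a::comm_ring_1 set \<Rightarrow> nat \<Rightarrow> 'a set" where
  "power_ideal I k = prod_ideals (\<lambda>_. I) {1..k}"

section \<open>Monomial and matroidal ideals\<close>

definition monomial_ideal :: "('n::finite, 'k::field) mpoly set \<Rightarrow> bool" where
  "monomial_ideal I \<longleftrightarrow> (\<exists>B \<subseteq> range mon. I = ideal.span B)"

definition minimal_monomial_generators ::
    "('n::finite, 'k::field) mpoly set \<Rightarrow> ('n, 'k) mpoly set \<Rightarrow> bool" where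
  "minimal_monomial_generators I B \<longleftrightarrow>
     B \<subseteq> range mon \<and> ideal.span B = I \<and> (\<forall>C. C \<subset> B \<longrightarrow> ideal.span C \<noteq> I)"

text \<open>
  \<open>min_gens I\<close> is the set usually written \<open>G(I)\<close>. Existence and uniqueness of the minimal generators are shown
  in lemma \<open>ex1_minimal_monomial_generators\<close> below.
\<close>

definition min_gens :: "('n::finite, 'k::field) mpoly set \<Rightarrow> ('n, 'k) mpoly set" where
  "min_gens I = (THE B. minimal_monomial_generators I B)"

definition generated_in_degree :: "('n::finite, 'k::field) mpoly set \<Rightarrow> nat \<Rightarrow> bool" where
  "generated_in_degree I d \<longleftrightarrow> min_gens I \<subseteq> mon ` {m. exp_degree m = d}"

text \<open>
  In the exchange property, \<open>u/x\<^sub>i\<close> is the (unique) \<open>w\<close> with \<open>u = x\<^sub>i w\<close>.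
\<close>

definition matroidal :: "('n::finite, 'k::field) mpoly set \<Rightarrow> bool" where
  "matroidal I \<longleftrightarrow>
     monomial_ideal I \<and> I \<noteq> {0} \<and> (\<forall>u\<in>min_gens I. squarefree u) \<and> (\<exists>d. generated_in_degree I d) \<and>
     (\<forall>u\<in>min_gens I. \<forall>v\<in>min_gens I. \<forall>i. Var i dvd u \<and> \<not> Var i dvd v \<longrightarrow>
        (\<exists>j. j \<noteq> i \<and> Var j dvd v \<and> \<not> Var j dvd u \<and> (\<exists>w. u = Var i * w \<and> w * Var j \<in> min_gens I)))"

definition Supp :: "('n::finite, 'k::field) mpoly set \<Rightarrow> ('n, 'k) mpoly set" where
  "Supp I = {Var i | i. \<exists>u\<in>min_gens I. Var i dvd u}"

text \<open>
  The polynomial ring is not equipped with a gcd operation, so \<open>gcd(I) = g\<close> is the relation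
  that \<open>g\<close> is a greatest common divisor of \<open>min_gens I\<close>.
\<close>

definition is_gcd :: "'a::comm_monoid_mult \<Rightarrow> 'a set \<Rightarrow> bool" where
  "is_gcd g A \<longleftrightarrow> (\<forall>a\<in>A. g dvd a) \<and> (\<forall>h. (\<forall>a\<in>A. h dvd a) \<longrightarrow> h dvd g)"

definition monomial_prime :: "'n set \<Rightarrow> ('n::finite, 'k::field) mpoly set" where
  "monomial_prime A = ideal.span (Var ` A)"

section \<open>Depth\<close>

text \<open>
  \<open>fs\<close> is a regular sequence on the module \<open>S/J\<close>: multiplication by \<open>fs ! i\<close> is injective on
  \<open>S/(J + (fs ! 0, \<dots>, fs ! (i - 1)))\<close> for each \<open>i\<close>, and \<open>S/(J + (fs))\<close> is nonzero.
\<close>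

definition regular_sequence_mod :: "'a::comm_ring_1 set \<Rightarrow> 'a list \<Rightarrow> bool" where
  "regular_sequence_mod J fs \<longleftrightarrow>
     (\<forall>i<length fs. \<forall>g. fs ! i * g \<in> ideal.span (J \<union> set (take i fs)) \<longrightarrow>
        g \<in> ideal.span (J \<union> set (take i fs))) \<and>
     ideal.span (J \<union> set fs) \<noteq> UNIV"

definition max_graded_ideal :: "('n::finite, 'k::field) mpoly set" where
  "max_graded_ideal = ideal.span (range Var)"

text \<open>
  \<open>depth_quot J\<close> is the depth of \<open>S/J\<close>, the maximal length of a regular sequence on \<open>S/J\<close> with
  entries in the graded maximal ideal.
\<close>

definition depth_quot :: "('n::finite, 'k::field) mpoly set \<Rightarrow> enat" where
  "depth_quot J =
     Sup {enat (length fs) | fs. set fs \<subseteq> max_graded_ideal \<and> regular_sequence_mod J fs}"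

definition depth_function :: "('n::finite, 'k::field) mpoly set \<Rightarrow> nat \<Rightarrow> enat" where
  "depth_function L k = depth_quot (power_ideal L k)"

definition constant_depth_function :: "('n::finite, 'k::field) mpoly set \<Rightarrow> bool" where
  "constant_depth_function L \<longleftrightarrow> (\<forall>k\<ge>1. depth_function L k = depth_quot L)"

section \<open>Existence and uniqueness of the minimal monomial generators\<close>

lemma mon_mult: "mon a * mon b = (mon (a + b) :: ('n, 'k::field) mpoly)"
  by (simp add: mon_def mult_single)

lemma mon_inject: "(mon a :: ('n, 'k::field) mpoly) = mon b \<longleftrightarrow> a = b"
  proof
  assume "(mon a :: ('n, 'k) mpoly) = mon b"
  then have "Poly_Mapping.keys (mon a :: ('n, 'k) mpoly) = Poly_Mapping.keys (mon b :: ('n, 'k) mpoly)"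
    by (rule arg_cong)
  then show "a = b" by (simp add: mon_def)
qed simp

lemma inj_mon: "inj (mon :: _ \<Rightarrow> ('n, 'k::field) mpoly)"
  by (simp add: inj_def mon_inject)

lemma keys_span_mon:
  fixes p :: "('n::finite, 'k::field) mpoly"
  assumes "p \<in> ideal.span (mon ` A)" "m \<in> Poly_Mapping.keys p"
  shows "\<exists>a\<in>A. \<exists>c. m = a + c"
proof -
  let ?Q = "{p :: ('n, 'k) mpoly. \<forall>m\<in>Poly_Mapping.keys p. \<exists>a\<in>A. \<exists>c. m = a + c}"
  have "ideal.subspace ?Q"
  proof (rule ideal.subspaceI)
    fix x y :: "('n, 'k) mpoly" assume "x \<in> ?Q" "y \<in> ?Q"
    then show "x + y \<in> ?Q" using keys_add[of x y] by blast
  next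
    fix c x :: "('n, 'k) mpoly" assume x: "x \<in> ?Q"
    show "c * x \<in> ?Q"
    proof (intro CollectI ballI)
      fix m assume "m \<in> Poly_Mapping.keys (c * x)"
      then obtain s t where st: "m = s + t" "t \<in> Poly_Mapping.keys x"
        using keys_mult[of c x] by blast
      then obtain a e where "a \<in> A" "t = a + e" using x by blast
      then have "m = a + (s + e)" using st by (simp add: ac_simps)
      then show "\<exists>a\<in>A. \<exists>c. m = a + c" using \<open>a \<in> A\<close> by blast
    qed
  qed simp
  moreover have "mon ` A \<subseteq> ?Q"
    by (auto simp: mon_def) (metis add.right_neutral)
  ultimately show ?thesis using assms ideal.span_minimal by blast
qed

lemma mon_in_span_iff:
  "(mon m :: ('n::finite, 'k::field) mpoly) \<in> ideal.span (mon ` A) \<longleftrightarrow> (\<exists>a\<in>A. \<exists>c. m = a + c)"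
proof
  assume "(mon m :: ('n, 'k) mpoly) \<in> ideal.span (mon ` A)"
  then show "\<exists>a\<in>A. \<exists>c. m = a + c"
    by (rule keys_span_mon) (simp add: mon_def)
next
  assume "\<exists>a\<in>A. \<exists>c. m = a + c"
  then obtain a c where "a \<in> A" "m = a + c" by blast
  then have "(mon m :: ('n, 'k) mpoly) = mon c * mon a"
    by (simp add: mon_mult add.commute)
  then show "(mon m :: ('n, 'k) mpoly) \<in> ideal.span (mon ` A)"
    using \<open>a \<in> A\<close> by (simp add: ideal.span_base ideal.span_scale)
qed

lemma exp_degree_add: "exp_degree (a + b) = exp_degree a + exp_degree b"
  by (simp add: exp_degree_def lookup_add sum.distrib)

lemma exp_degree_eq_0: "exp_degree a = 0 \<longleftrightarrow> a = 0"
  by (auto simp: exp_degree_def intro: poly_mapping_eqI)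

lemma minimal_monomial_generators_iff:
  fixes I :: "('n::finite, 'k::field) mpoly set"
  assumes "monomial_ideal I"
  shows "minimal_monomial_generators I B \<longleftrightarrow>
    B = mon ` {m. mon m \<in> I \<and> (\<forall>a c. mon a \<in> I \<longrightarrow> m = a + c \<longrightarrow> c = 0)}"
    (is "_ \<longleftrightarrow> B = mon ` ?M")
proof
  assume B: "minimal_monomial_generators I B"
  then obtain A where A: "B = mon ` A" and I: "I = ideal.span (mon ` A)"
    unfolding minimal_monomial_generators_def by (metis subset_image_iff)
  have "?M \<subseteq> A"
    by (auto simp: I mon_in_span_iff) (metis add.right_neutral)
  moreover have "A \<subseteq> ?M"
  proof (rule subsetI, rule ccontr)
    fix m assume m: "m \<in> A" "m \<notin> ?M"
    have "(mon m :: ('n, 'k) mpoly) \<in> I" using m by (auto simp: I ideal.span_base)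
    then obtain a c where ac: "(mon a :: ('n, 'k) mpoly) \<in> I" "m = a + c" "c \<noteq> 0"
      using m by blast
    then obtain b e where be: "b \<in> A" "a = b + e" by (auto simp: I mon_in_span_iff)
    have "exp_degree b < exp_degree m"
      using ac be exp_degree_eq_0[of c] by (simp add: exp_degree_add)
    then have "b \<in> A - {m}" using be by auto
    then have "(mon m :: ('n, 'k) mpoly) \<in> ideal.span (mon ` (A - {m}))"
      unfolding mon_in_span_iff using ac be by (metis add.assoc)
    then have "mon ` A \<subseteq> (ideal.span (mon ` (A - {m})) :: ('n, 'k) mpoly set)"
      by (auto intro: ideal.span_base)
    then have "ideal.span (mon ` (A - {m})) = I"
      unfolding I by (intro ideal.span_eq[THEN iffD2] conjI)
        (auto intro: ideal.span_base)
    moreover have "mon ` (A - {m}) \<subset> B"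
      using m(1) unfolding A by (auto simp: mon_inject psubset_eq inj_image_eq_iff[OF inj_mon])
    ultimately show False using B unfolding minimal_monomial_generators_def by blast
  qed
  ultimately show "B = mon ` ?M" using A by blast
next
  assume B: "B = mon ` ?M"
  obtain A where I: "I = ideal.span (mon ` A)"
    using assms unfolding monomial_ideal_def by (metis subset_image_iff)
  have below: "\<exists>a\<in>?M. \<exists>c. m = a + c" if "(mon m :: ('n, 'k) mpoly) \<in> I" for m
    using that
  proof (induction "exp_degree m" arbitrary: m rule: less_induct)
    case less
    show ?case
    proof (cases "m \<in> ?M")
      case True
      moreover have "m = m + 0" by simp
      ultimately show ?thesis by blast
    next
      case False
      then have "\<not> (\<forall>a c. (mon a :: ('n, 'k) mpoly) \<in> I \<longrightarrow> m = a + c \<longrightarrow> c = 0)"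
        using less.prems by simp
      then obtain a c where ac: "(mon a :: ('n, 'k) mpoly) \<in> I" "m = a + c" "c \<noteq> 0"
        by blast
      then have "exp_degree a < exp_degree m"
        using exp_degree_eq_0[of c] by (simp add: exp_degree_add)
      then obtain b e where "b \<in> ?M" "a = b + e" using less.hyps ac by blast
      moreover have "m = b + (e + c)" using ac(2) calculation(2) by (simp add: add.assoc)
      ultimately show ?thesis by blast
    qed
  qed
  have "mon ` A \<subseteq> (ideal.span (mon ` ?M) :: ('n, 'k) mpoly set)"
  proof (rule image_subsetI)
    fix a assume "a \<in> A"
    then have "(mon a :: ('n, 'k) mpoly) \<in> I" by (simp add: I ideal.span_base)
    then show "(mon a :: ('n, 'k) mpoly) \<in> ideal.span (mon ` ?M)"
      unfolding mon_in_span_iff by (rule below)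
  qed
  then have "I \<subseteq> ideal.span (mon ` ?M)"
    using ideal.span_minimal[OF _ ideal.subspace_span] unfolding I by blast
  moreover have "ideal.span (mon ` ?M) \<subseteq> I"
    by (rule ideal.span_minimal) (auto simp: I)
  moreover have "ideal.span C \<noteq> I" if C: "C \<subset> B" for C
  proof
    assume CI: "ideal.span C = I"
    have "C \<subseteq> mon ` ?M" using C unfolding B by (rule psubset_imp_subset)
    then obtain D where D: "C = mon ` D" "D \<subseteq> ?M" unfolding subset_image_iff by (elim exE conjE)
    have "D \<noteq> ?M" using C unfolding B D(1) by (rule contrapos_pn) simp
    then obtain m where m: "m \<in> ?M" "m \<notin> D" using D(2) by blast
    then have "(mon m :: ('n, 'k) mpoly) \<in> ideal.span (mon ` D)" using CI D by simp
    then obtain a c where ac: "a \<in> D" "m = a + c" by (auto simp: mon_in_span_iff)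
    then have "c = 0" using m D(2) by blast
    then show False using ac m by simp
  qed
  ultimately show "minimal_monomial_generators I B"
    unfolding minimal_monomial_generators_def B by blast
qed

lemma ex1_minimal_monomial_generators:
  "monomial_ideal I \<Longrightarrow> \<exists>!B. minimal_monomial_generators I B"
  by (simp add: minimal_monomial_generators_iff)

lemma minimal_monomial_generators_min_gens:
  "monomial_ideal I \<Longrightarrow> minimal_monomial_generators I (min_gens I)"
  unfolding min_gens_def by (rule theI') (rule ex1_minimal_monomial_generators)

end

theory Submission
  imports Defs
begin

text \<open>
  Let \<open>c\<close> be the number of connected components of the matroid whose bases are the supports of the generators
  of \<open>I\<close>. Deletion and contraction filter \<open>S/I\<close> by quotients \<open>S/(Z)\<close> with at least \<open>d - 1\<close> free variables,
  and the elementary symmetric polynomials of degrees \<open>d - 1, \<dots>, 1\<close> are a regular sequence on each of them;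
  so \<open>depth S/I \<ge> d - 1\<close> over every field. On the other hand some power has \<open>depth S/I\<^sup>k \<le> c - 1\<close>: a
  monomial \<open>u\<close> that is moved into \<open>I\<^sup>k\<close> exactly by the monomials involving all components yields a nonzero
  Koszul cohomology class of degree \<open>c - 1\<close>. As every component meets every basis, \<open>c \<le> d\<close>, and a constant
  depth function forces \<open>c = d\<close>, so that the bases are all the transversals of the components. Conversely, both
  bounds apply to all powers of a product of \<open>d\<close> primes in disjoint sets of variables and give \<open>d - 1\<close>.
\<close>

text \<open>The lower bound is read off from short exact sequences, and these transport a regular
  sequence only if the very same sequence is regular on both outer terms. Over an infinite field
  generic linear forms would do; a finite field may have too few of them. Elementary symmetric
  polynomials work because reduction modulo the variables in any set Z turns them into the
  elementary symmetric polynomials of the other variables, so one fixed list serves all Z at once.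

  The upper bound must exclude arbitrary regular sequences in the graded maximal ideal, hence the
  passage to an invariant: a regular sequence of length greater than i forces the Koszul cohomology
  in degree i to vanish, so a single nonzero class bounds the depth.

  The power k arises because a relation between two elements of one component may need sums of
  several bases. Adding one such relation for every variable gives an exponent with a gap in each
  component that any element of the component can fill, independently of the choices in the other
  components.\<close>

abbreviation keys :: "('a \<Rightarrow>\<^sub>0 'b::zero) \<Rightarrow> 'a set" where "keys \<equiv> Poly_Mapping.keys"
abbreviation lookup :: "('a \<Rightarrow>\<^sub>0 'b::zero) \<Rightarrow> 'a \<Rightarrow> 'b" where "lookup \<equiv> Poly_Mapping.lookup"

section \<open>Monomial ideals as sets of exponent vectors\<close>

definition up_closed :: "('n \<Rightarrow>\<^sub>0 nat) set \<Rightarrow> bool" where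
  "up_closed U \<longleftrightarrow> (\<forall>m\<in>U. \<forall>c. m + c \<in> U)"

text \<open>For \<open>up_closed U\<close> this is the monomial ideal with the monomials of
  \<open>U\<close> as K-basis. In this form sums of ideals and colons by monomials become set
  operations on exponents.\<close>

definition poly_supported :: "('n \<Rightarrow>\<^sub>0 nat) set \<Rightarrow> ('n::finite, 'k::field) mpoly set" where
  "poly_supported U = {p. keys p \<subseteq> U}"

lemma up_closedI: "(\<And>m c. m \<in> U \<Longrightarrow> m + c \<in> U) \<Longrightarrow> up_closed U"
  by (simp add: up_closed_def)

lemma up_closedD: "up_closed U \<Longrightarrow> m \<in> U \<Longrightarrow> m + c \<in> U"
  by (simp add: up_closed_def)

lemma keys_nat_add: "keys (a + b) = keys a \<union> keys b" for a b :: "'n \<Rightarrow>\<^sub>0 nat"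
  by (auto simp: in_keys_iff lookup_add)

lemma sum_keys_single: "(\<Sum>m\<in>keys p. Poly_Mapping.single m (lookup p m)) = p"
  by (rule poly_mapping_eqI) (auto simp: lookup_sum lookup_single when_def sum.delta' in_keys_iff)

lemma lookup_mon_times: "lookup (mon a * p) (a + m) = lookup p m"
  by (simp add: mon_def lookup_mult lookup_single when_mult)

lemma keys_mon_times: "keys (mon a * p) = (+) a ` keys p"
proof
  show "keys (mon a * p) \<subseteq> (+) a ` keys p"
    using keys_mult[of "mon a" p] by (auto simp: mon_def)
  show "(+) a ` keys p \<subseteq> keys (mon a * p)"
    by (auto simp: in_keys_iff lookup_mon_times)
qed

lemma keys_mon [simp]: "keys (mon m :: ('n, 'k::field) mpoly) = {m}"
  by (simp add: mon_def)

lemma mon_mem_poly_supported [simp]: "mon m \<in> poly_supported U \<longleftrightarrow> m \<in> U"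
  by (simp add: poly_supported_def)

lemma mon_zero: "mon 0 = (1 :: ('n, 'k::field) mpoly)"
  by (simp add: mon_def)

definition up_closure :: "('n \<Rightarrow>\<^sub>0 nat) set \<Rightarrow> ('n \<Rightarrow>\<^sub>0 nat) set" where
  "up_closure A = {m. \<exists>a\<in>A. \<exists>c. m = a + c}"

lemma up_closed_up_closure: "up_closed (up_closure A)"
  by (rule up_closedI) (fastforce simp: up_closure_def add.assoc)

lemma subset_up_closure: "A \<subseteq> up_closure A"
  by (auto simp: up_closure_def) (metis add.right_neutral)

lemma up_closure_eq: "up_closed U \<Longrightarrow> up_closure U = U"
  using subset_up_closure[of U] by (auto simp: up_closure_def up_closed_def)

lemma up_closure_insert: "up_closure (insert a U) = {m. \<exists>c. m = a + c} \<union> up_closure U"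
  by (auto simp: up_closure_def)

lemma span_mon: "ideal.span (mon ` A) = poly_supported (up_closure A)"
proof
  show "ideal.span (mon ` A) \<subseteq> poly_supported (up_closure A)"
    using keys_span_mon by (fastforce simp: poly_supported_def up_closure_def)
  show "poly_supported (up_closure A) \<subseteq> (ideal.span (mon ` A) :: ('a, 'b) mpoly set)"
  proof
    fix p :: "('a, 'b) mpoly" assume p: "p \<in> poly_supported (up_closure A)"
    have "(\<Sum>m\<in>keys p. Poly_Mapping.single m (lookup p m)) \<in> ideal.span (mon ` A)"
    proof (rule ideal.span_sum)
      fix m assume "m \<in> keys p"
      then obtain a c where "a \<in> A" "m = a + c"
        using p by (auto simp: poly_supported_def up_closure_def)
      then have "Poly_Mapping.single m (lookup p m) = Poly_Mapping.single c (lookup p m) * mon a"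
        by (simp add: mon_def mult_single add.commute)
      then show "Poly_Mapping.single m (lookup p m) \<in> ideal.span (mon ` A)"
        using \<open>a \<in> A\<close> by (simp add: ideal.span_base ideal.span_scale)
    qed
    then show "p \<in> ideal.span (mon ` A)" by (simp add: sum_keys_single)
  qed
qed

lemma poly_supported_eq_span: "up_closed U \<Longrightarrow> poly_supported U = ideal.span (mon ` U)"
  by (simp add: span_mon up_closure_eq)

lemma subspace_poly_supported: "up_closed U \<Longrightarrow> ideal.subspace (poly_supported U)"
  by (simp add: poly_supported_eq_span)

lemma mon_times_mem_poly_supported: "mon a * p \<in> poly_supported U \<longleftrightarrow> p \<in> poly_supported {m. a + m \<in> U}"
  by (auto simp: poly_supported_def keys_mon_times)

lemma span_insert_span: "ideal.span (insert a (ideal.span A)) = ideal.span (insert a A)"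
  by (intro ideal.span_eq[THEN iffD2] conjI)
    (auto intro: ideal.span_base subsetD[OF ideal.span_mono, rotated])

lemma span_insert_mon:
  assumes "up_closed U"
  shows "ideal.span (insert (mon a) (poly_supported U)) = poly_supported ({m. \<exists>c. m = a + c} \<union> U)"
proof -
  have "ideal.span (insert (mon a) (poly_supported U)) = ideal.span (mon ` insert a U)"
    unfolding poly_supported_eq_span[OF assms] by (simp add: span_insert_span)
  also have "\<dots> = poly_supported (up_closure (insert a U))" by (rule span_mon)
  finally show ?thesis by (simp add: up_closure_insert up_closure_eq[OF assms])
qed

definition chi :: "'n::finite set \<Rightarrow> 'n \<Rightarrow>\<^sub>0 nat" where
  "chi B = (\<Sum>v\<in>B. Poly_Mapping.single v 1)"

lemma lookup_chi [simp]: "lookup (chi B) v = of_bool (v \<in> B)"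
  by (simp add: chi_def lookup_sum lookup_single when_def)

lemma keys_chi [simp]: "keys (chi B) = B"
  by (auto simp: in_keys_iff)

lemma chi_singleton: "chi {v} = Poly_Mapping.single v 1"
  by (simp add: chi_def)

lemma Var_eq: "Var v = mon (chi {v})"
  by (simp add: Var_def chi_singleton)

lemma chi_eq_sum: "chi B = (\<Sum>v\<in>B. chi {v})"
  by (simp add: chi_def)

lemma chi_add_iff: "(\<exists>c. m = chi B + c) \<longleftrightarrow> B \<subseteq> keys m"
proof
  assume "B \<subseteq> keys m"
  then have "m = chi B + (m - chi B)"
    by (intro poly_mapping_eqI) (auto simp: lookup_add lookup_minus in_keys_iff)
  then show "\<exists>c. m = chi B + c" by blast
qed (auto simp: keys_nat_add)

lemma span_insert_Var:
  assumes "up_closed U"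
  shows "ideal.span (insert (Var v) (poly_supported U)) = poly_supported ({m. v \<in> keys m} \<union> U)"
  unfolding Var_eq span_insert_mon[OF assms] by (simp add: chi_add_iff)

lemma monomial_prime_eq: "monomial_prime A = poly_supported {m. keys m \<inter> A \<noteq> {}}"
proof -
  have "monomial_prime A = ideal.span (mon ` (\<lambda>v. chi {v}) ` A)"
    by (simp add: monomial_prime_def Var_eq image_image)
  also have "\<dots> = poly_supported {m. keys m \<inter> A \<noteq> {}}"
    unfolding span_mon by (rule arg_cong[of _ _ poly_supported])
      (auto simp: up_closure_def chi_add_iff)
  finally show ?thesis .
qed

lemma max_graded_ideal_eq: "max_graded_ideal = poly_supported {m. m \<noteq> 0}"
  using monomial_prime_eq[of UNIV] by (simp add: max_graded_ideal_def monomial_prime_def)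

section \<open>Weakly regular sequences\<close>

text \<open>The last quotient is allowed to be zero. Inductions along filtrations can therefore end
  in the zero module, on which every sequence is weakly regular; properness is checked once, when
  the depth is computed.\<close>

fun wreg :: "'a::comm_ring_1 set \<Rightarrow> 'a list \<Rightarrow> bool" where
  "wreg J [] \<longleftrightarrow> True"
| "wreg J (f # fs) \<longleftrightarrow> (\<forall>g. f * g \<in> J \<longrightarrow> g \<in> J) \<and> wreg (ideal.span (insert f J)) fs"

lemma span_union_span: "ideal.span (ideal.span A \<union> B) = ideal.span (A \<union> B)"
  by (intro ideal.span_eq[THEN iffD2] conjI)
    (auto intro: ideal.span_base subsetD[OF ideal.span_mono, rotated])

lemma mem_span_insert:
  assumes "ideal.subspace J"
  shows "g \<in> ideal.span (insert f J) \<longleftrightarrow> (\<exists>j\<in>J. \<exists>h. g = j + f * h)"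
proof -
  have "g \<in> ideal.span (insert f J) \<longleftrightarrow> (\<exists>h. g - h * f \<in> J)"
    using assms by (simp add: ideal.span_insert flip: ideal.span_eq_iff)
  also have "\<dots> \<longleftrightarrow> (\<exists>j\<in>J. \<exists>h. g = j + f * h)"
    by (metis add_diff_cancel_right' diff_add_cancel mult.commute)
  finally show ?thesis .
qed

lemma wreg_iff:
  assumes "ideal.subspace J"
  shows "wreg J fs \<longleftrightarrow> (\<forall>i<length fs. \<forall>g. fs ! i * g \<in> ideal.span (J \<union> set (take i fs)) \<longrightarrow>
        g \<in> ideal.span (J \<union> set (take i fs)))"
  using assms
proof (induction fs arbitrary: J)
  case (Cons f fs)
  have *: "ideal.span (ideal.span (insert f J) \<union> A) = ideal.span (insert f (J \<union> A))" for A
    by (simp add: span_union_span)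
  have "ideal.span J = J" using Cons.prems by simp
  moreover have "wreg (ideal.span (insert f J)) fs \<longleftrightarrow> (\<forall>i<length fs. \<forall>g.
      fs ! i * g \<in> ideal.span (insert f (J \<union> set (take i fs))) \<longrightarrow>
      g \<in> ideal.span (insert f (J \<union> set (take i fs))))"
    using Cons.IH[of "ideal.span (insert f J)"] by (simp add: *)
  ultimately show ?case by (simp del: ideal.span_eq_iff add: All_less_Suc2)
qed simp

lemma wreg_UNIV: "wreg UNIV fs"
proof (induction fs)
  case (Cons f fs)
  have "ideal.span UNIV = (UNIV :: 'a set)" by (simp add: ideal.span_UNIV)
  then show ?case using Cons by simp
qed simp

lemma span_insert_commute:
  "ideal.span (insert a (ideal.span (insert b J))) = ideal.span (insert b (ideal.span (insert a J)))"
  using span_union_span[of "insert b J" "{a}"] span_union_span[of "insert a J" "{b}"]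
  by (simp add: insert_commute)

text \<open>The exact sequence \<open>0 \<rightarrow> S/(J : x) \<rightarrow> S/J \<rightarrow> S/(J + (x)) \<rightarrow> 0\<close>.\<close>

lemma wreg_extension:
  assumes "ideal.subspace J" "ideal.subspace L" "\<And>g. g \<in> L \<longleftrightarrow> x * g \<in> J"
    and "wreg L fs" "wreg (ideal.span (insert x J)) fs"
  shows "wreg J fs"
  using assms
proof (induction fs arbitrary: J L)
  case (Cons f fs)
  note J = Cons.prems(1) and L = Cons.prems(2) and colon = Cons.prems(3)
  have reg_L: "g \<in> L" if "f * g \<in> L" for g using Cons.prems(4) that by simp
  have reg_x: "g \<in> ideal.span (insert x J)" if "f * g \<in> ideal.span (insert x J)" for g
    using Cons.prems(5) that by simp
  have JL: "j \<in> J \<Longrightarrow> j \<in> L" for j using colon J ideal.subspace_scale by blast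
  have "g \<in> J" if "f * g \<in> J" for g
  proof -
    have "f * g \<in> ideal.span (insert x J)" using that by (simp add: ideal.span_base)
    then obtain j h where jh: "j \<in> J" "g = j + x * h"
      using reg_x mem_span_insert[OF J] by blast
    have "x * (f * h) = f * g - f * j" using jh by (simp add: algebra_simps)
    also have "\<dots> \<in> J" using that jh J by (simp add: ideal.subspace_diff ideal.subspace_scale)
    finally have "x * h \<in> J" using colon reg_L by blast
    then show ?thesis using jh J by (simp add: ideal.subspace_add)
  qed
  moreover have "wreg (ideal.span (insert f J)) fs"
  proof (rule Cons.IH)
    \<comment> \<open>The colon by \<open>x\<close> commutes with adding \<open>f\<close>: if x g =
      j + f h, then f h lies in J + (x), hence so does h by regularity of \<open>f\<close> there,
      and a multiple of \<open>f\<close> can be subtracted from g to land in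
      \<open>L\<close>.\<close>
    show "g \<in> ideal.span (insert f L) \<longleftrightarrow> x * g \<in> ideal.span (insert f J)" for g
    proof
      assume "g \<in> ideal.span (insert f L)"
      then obtain l h where "l \<in> L" "g = l + f * h" using mem_span_insert[OF L] by blast
      then have "x * l \<in> J" "x * g = x * l + f * (x * h)"
        using colon by (auto simp: algebra_simps)
      then show "x * g \<in> ideal.span (insert f J)" using mem_span_insert[OF J] by blast
    next
      assume "x * g \<in> ideal.span (insert f J)"
      then obtain j h where jh: "j \<in> J" "x * g = j + f * h" using mem_span_insert[OF J] by blast
      have "f * h = x * g - j" using jh by simp
      also have "\<dots> \<in> ideal.span (insert x J)" using jh
        by (metis ideal.span_diff ideal.span_scale ideal.span_base insertCI mult.commute)
      finally obtain j' h' where jh': "j' \<in> J" "h = j' + x * h'"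
        using reg_x mem_span_insert[OF J] by blast
      have "x * (g - f * h') = j + f * j'" using jh jh' by (simp add: algebra_simps)
      also have "\<dots> \<in> J" using jh jh' J by (simp add: ideal.subspace_add ideal.subspace_scale)
      finally have "g - f * h' \<in> L" using colon by blast
      moreover have "g = (g - f * h') + f * h'" by simp
      ultimately show "g \<in> ideal.span (insert f L)" using mem_span_insert[OF L] by blast
    qed
    show "wreg (ideal.span (insert f L)) fs" using Cons.prems(4) by simp
    show "wreg (ideal.span (insert x (ideal.span (insert f J)))) fs"
      using Cons.prems(5) by (simp add: span_insert_commute)
  qed simp_all
  ultimately show ?case by simp
qed simp

text \<open>For a variable both outer terms are monomial again: the colon shifts the exponent set,
  and adding the variable adjoins all exponents whose support contains it.\<close>

lemma wreg_poly_supported_extension: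
  assumes "up_closed U" "wreg (poly_supported {m. chi {v} + m \<in> U}) fs"
    and "wreg (poly_supported ({m. v \<in> keys m} \<union> U)) fs"
  shows "wreg (poly_supported U) fs"
proof (rule wreg_extension)
  have "up_closed {m. chi {v} + m \<in> U}"
    using assms(1) by (simp add: up_closed_def add.assoc[symmetric])
  then show "ideal.subspace (poly_supported {m. chi {v} + m \<in> U})"
    by (rule subspace_poly_supported)
  show "g \<in> poly_supported {m. chi {v} + m \<in> U} \<longleftrightarrow> Var v * g \<in> poly_supported U" for g
    by (simp add: Var_eq mon_times_mem_poly_supported)
qed (use assms in \<open>simp_all add: subspace_poly_supported span_insert_Var\<close>)

section \<open>Truncation by degree\<close>

definition truncate :: "nat \<Rightarrow> ('n::finite, 'k::field) mpoly \<Rightarrow> ('n, 'k) mpoly" where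
  "truncate N p = Abs_poly_mapping (\<lambda>m. if exp_degree m < N then lookup p m else 0)"

lemma lookup_truncate: "lookup (truncate N p) m = (if exp_degree m < N then lookup p m else 0)"
proof -
  have "finite {m. (if exp_degree m < N then lookup p m else 0) \<noteq> 0}"
    by (rule finite_subset[OF _ finite_keys[of p]]) (auto simp: in_keys_iff split: if_splits)
  then show ?thesis by (simp add: truncate_def)
qed

lemma keys_truncate: "keys (truncate N p) = {m \<in> keys p. exp_degree m < N}"
  by (auto simp: in_keys_iff lookup_truncate split: if_splits)

lemma truncate_add: "truncate N (p + q) = truncate N p + truncate N q"
  by (rule poly_mapping_eqI) (simp add: lookup_add lookup_truncate)

lemma truncate_id: "(\<And>m. m \<in> keys p \<Longrightarrow> exp_degree m < N) \<Longrightarrow> truncate N p = p"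
  by (rule poly_mapping_eqI) (auto simp: lookup_truncate in_keys_iff)

lemma truncate_eq_0: "(\<And>m. m \<in> keys p \<Longrightarrow> exp_degree m \<ge> N) \<Longrightarrow> truncate N p = 0"
  by (rule poly_mapping_eqI) (force simp: lookup_truncate in_keys_iff)

definition homogeneous :: "nat \<Rightarrow> ('n::finite, 'k::field) mpoly \<Rightarrow> bool" where
  "homogeneous e f \<longleftrightarrow> (\<forall>m\<in>keys f. exp_degree m = e)"

lemma truncate_homogeneous_mult:
  assumes "homogeneous e f"
  shows "truncate N (f * g) = f * truncate (N - e) g"
proof -
  let ?g = "truncate (N - e) g"
  have deg: "exp_degree m = e" if "m \<in> keys f" for m using assms that by (simp add: homogeneous_def)
  have "truncate N (f * ?g) = f * ?g"
    using keys_mult[of f ?g] deg by (intro truncate_id) (fastforce simp: keys_truncate exp_degree_add)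
  moreover have "truncate N (f * (g - ?g)) = 0"
  proof (rule truncate_eq_0)
    fix m assume "m \<in> keys (f * (g - ?g))"
    then obtain s t where "m = s + t" "s \<in> keys f" "t \<in> keys (g - ?g)"
      using keys_mult[of f "g - ?g"] by blast
    moreover from this have "exp_degree t \<ge> N - e"
      by (auto simp: in_keys_iff lookup_minus lookup_truncate not_less split: if_splits)
    ultimately show "exp_degree m \<ge> N" using deg by (simp add: exp_degree_add)
  qed
  moreover have "f * g = f * ?g + f * (g - ?g)" by (simp add: algebra_simps)
  ultimately show ?thesis by (simp add: truncate_add)
qed

text \<open>Homogeneity of an ideal, expressed without a decomposition into graded pieces: the
  component of degree N is a difference of two truncations.\<close>

definition truncation_closed :: "('n::finite, 'k::field) mpoly set \<Rightarrow> bool" where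
  "truncation_closed J \<longleftrightarrow> (\<forall>N. \<forall>p\<in>J. truncate N p \<in> J)"

lemma truncation_closed_poly_supported: "truncation_closed (poly_supported U)"
  by (auto simp: truncation_closed_def poly_supported_def keys_truncate)

lemma truncation_closed_span_insert:
  assumes "ideal.subspace J" "truncation_closed J" "homogeneous e f"
  shows "truncation_closed (ideal.span (insert f J))"
  unfolding truncation_closed_def
proof (intro allI ballI)
  fix N p assume "p \<in> ideal.span (insert f J)"
  then obtain j h where "j \<in> J" "p = j + f * h" using mem_span_insert[OF assms(1)] by blast
  then have "truncate N p = truncate N j + f * truncate (N - e) h" "truncate N j \<in> J"
    using assms by (simp_all add: truncate_add truncate_homogeneous_mult truncation_closed_def)
  then show "truncate N p \<in> ideal.span (insert f J)" using mem_span_insert[OF assms(1)] by blast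
qed

lemma exp_degree_chi: "exp_degree (chi B) = card B"
  by (simp add: exp_degree_def)

lemma keys_Var_power_mult:
  assumes "m \<in> keys (Var v ^ N * h)" shows "exp_degree m \<ge> N"
  using assms
proof (induction N arbitrary: m)
  case (Suc N)
  have "m \<in> keys (mon (chi {v}) * (Var v ^ N * h))"
    using Suc.prems by (simp add: Var_eq mult.assoc)
  then obtain m' where "m' \<in> keys (Var v ^ N * h)" "m = chi {v} + m'"
    by (auto simp: keys_mon_times)
  then show ?case using Suc.IH by (auto simp: exp_degree_add exp_degree_chi)
qed simp

text \<open>
  The graded version of permuting \<open>x, f\<^sub>1, \<dots>, f\<^sub>s\<close> into \<open>f\<^sub>1, \<dots>, f\<^sub>s, x\<close>; closure under
  truncation replaces Krull's intersection theorem.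
\<close>

lemma wreg_of_wreg_mod_Var:
  assumes "ideal.subspace J" "truncation_closed J" "\<forall>f\<in>set fs. \<exists>e. homogeneous e f"
    and "\<And>g. Var v * g \<in> J \<Longrightarrow> g \<in> J" "wreg (ideal.span (insert (Var v) J)) fs"
  shows "wreg J fs"
  using assms
proof (induction fs arbitrary: J)
  case (Cons f fs)
  note J = Cons.prems(1) and trunc = Cons.prems(2) and reg_v = Cons.prems(4)
  have reg_f: "g \<in> ideal.span (insert (Var v) J)" if "f * g \<in> ideal.span (insert (Var v) J)" for g
    using Cons.prems(5) that by simp
  have "g \<in> J" if g: "f * g \<in> J" for g
  proof -
    \<comment> \<open>One more power of the variable is gained by writing h modulo J +
      (\<open>Var v\<close>), where \<open>f\<close> is regular, and then cancelling
      \<open>Var v\<close> modulo \<open>J\<close> so that f h' stays in \<open>J\<close>.\<close>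
    have "\<exists>j\<in>J. \<exists>h. g = j + Var v ^ N * h \<and> f * h \<in> J" for N
    proof (induction N)
      case 0
      show ?case using g J by (intro bexI[of _ 0]) (auto simp: ideal.subspace_0)
    next
      case (Suc N)
      then obtain j h where jh: "j \<in> J" "g = j + Var v ^ N * h" "f * h \<in> J" by blast
      then obtain j' h' where jh': "j' \<in> J" "h = j' + Var v * h'"
        using reg_f[of h] mem_span_insert[OF J] by (metis ideal.span_base insertCI)
      have "Var v * (f * h') = f * h - f * j'" using jh' by (simp add: algebra_simps)
      also have "\<dots> \<in> J" using jh jh' J by (simp add: ideal.subspace_diff ideal.subspace_scale)
      finally have "f * h' \<in> J" by (rule reg_v)
      moreover have "g = (j + Var v ^ N * j') + Var v ^ Suc N * h'"
        using jh jh' by (simp add: algebra_simps)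
      moreover have "j + Var v ^ N * j' \<in> J"
        using jh jh' J by (simp add: ideal.subspace_add ideal.subspace_scale)
      ultimately show ?case by blast
    qed
    \<comment> \<open>\<open>N\<close> exceeds every degree occurring in \<open>g\<close>:
      truncation keeps \<open>g\<close> and removes the multiple of the N-th power, so only the part
      from \<open>J\<close> remains.\<close>
    moreover define N where "N = Suc (Max (exp_degree ` keys g))"
    ultimately obtain j h where jh: "j \<in> J" "g = j + Var v ^ N * h" by blast
    have "truncate N g = g"
      by (rule truncate_id) (auto simp: N_def less_Suc_eq_le)
    moreover have "truncate N (Var v ^ N * h) = 0"
      by (rule truncate_eq_0) (rule keys_Var_power_mult)
    ultimately have "g = truncate N j" using jh(2) truncate_add[of N j "Var v ^ N * h"] by simp
    then show ?thesis using trunc jh(1) by (simp add: truncation_closed_def)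
  qed
  moreover have "wreg (ideal.span (insert f J)) fs"
  proof (rule Cons.IH)
    obtain e where "homogeneous e f" using Cons.prems(3) by auto
    then show "truncation_closed (ideal.span (insert f J))"
      using truncation_closed_span_insert J trunc by blast
    show "g \<in> ideal.span (insert f J)" if vg: "Var v * g \<in> ideal.span (insert f J)" for g
    proof -
      obtain j h where jh: "j \<in> J" "Var v * g = j + f * h"
        using vg mem_span_insert[OF J] by blast
      have "f * h = Var v * g - j" using jh by simp
      also have "\<dots> \<in> ideal.span (insert (Var v) J)" using jh
        by (metis ideal.span_diff ideal.span_scale ideal.span_base insertCI mult.commute)
      finally obtain j' h' where jh': "j' \<in> J" "h = j' + Var v * h'"
        using reg_f mem_span_insert[OF J] by blast
      have "Var v * (g - f * h') = j + f * j'" using jh jh' by (simp add: algebra_simps)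
      also have "\<dots> \<in> J" using jh jh' J by (simp add: ideal.subspace_add ideal.subspace_scale)
      finally have "g - f * h' \<in> J" by (rule reg_v)
      moreover have "g = (g - f * h') + f * h'" by simp
      ultimately show ?thesis using mem_span_insert[OF J] by blast
    qed
    show "wreg (ideal.span (insert (Var v) (ideal.span (insert f J)))) fs"
      using Cons.prems(5) by (simp add: span_insert_commute)
  qed (use Cons.prems in simp_all)
  ultimately show ?case by simp
qed simp

section \<open>The elementary symmetric polynomials as a universal regular sequence\<close>

definition esym :: "nat \<Rightarrow> ('n::finite, 'k::field) mpoly" where
  "esym i = (\<Sum>B | card B = i. mon (chi B))"

text \<open>The degrees decrease from \<open>s\<close> to 1. When just \<open>s\<close> variables
  are free, the leading entry is their product, and what follows is the list for one free variable
  less.\<close>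

fun esyms :: "nat \<Rightarrow> ('n::finite, 'k::field) mpoly list" where
  "esyms 0 = []"
| "esyms (Suc s) = esym (Suc s) # esyms s"

lemma length_esyms [simp]: "length (esyms s) = s"
  by (induction s) auto

lemma keys_sum_subset: "keys (sum f A) \<subseteq> (\<Union>a\<in>A. keys (f a))"
  by (auto simp: in_keys_iff lookup_sum) (meson sum.not_neutral_contains_not_neutral)

lemma keys_esym: "m \<in> keys (esym i) \<Longrightarrow> \<exists>B. card B = i \<and> m = chi B"
  using keys_sum_subset[of "\<lambda>B. mon (chi B)" "{B. card B = i}"] by (auto simp: esym_def)

lemma homogeneous_esym: "homogeneous i (esym i)"
  unfolding homogeneous_def by (metis keys_esym exp_degree_chi)

lemma homogeneous_esyms: "\<forall>f\<in>set (esyms s). \<exists>e. homogeneous e f"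
  by (induction s) (auto intro: homogeneous_esym)

lemma esym_in_max_graded_ideal: "i > 0 \<Longrightarrow> esym i \<in> max_graded_ideal"
  using keys_esym
  by (fastforce simp: max_graded_ideal_eq poly_supported_def exp_degree_chi simp flip: exp_degree_eq_0)

lemma esyms_subset: "set (esyms s) \<subseteq> max_graded_ideal"
  by (induction s) (auto intro: esym_in_max_graded_ideal)

abbreviation hits :: "'n set \<Rightarrow> ('n \<Rightarrow>\<^sub>0 nat) set" where
  "hits Z \<equiv> {m. keys m \<inter> Z \<noteq> {}}"

abbreviation covers :: "'n set \<Rightarrow> ('n \<Rightarrow>\<^sub>0 nat) set" where
  "covers B \<equiv> {m. B \<subseteq> keys m}"

lemma up_closed_hits: "up_closed (hits Z)"
  by (rule up_closedI) (auto simp: keys_nat_add)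

lemma up_closed_Un: "up_closed U \<Longrightarrow> up_closed V \<Longrightarrow> up_closed (U \<union> V)"
  by (auto simp: up_closed_def)

lemma up_closed_covers: "up_closed (covers B)"
  by (rule up_closedI) (auto simp: keys_nat_add)

text \<open>Modulo the product of the variables in \<open>B\<close> the quotient is filtered by the
  rings in which one of these variables is killed: the colon by \<open>v\<close> removes
  \<open>v\<close> from the product, until the unit ideal is reached.\<close>

lemma wreg_hits_covers:
  fixes fs :: "('n::finite, 'k::field) mpoly list"
  assumes "\<And>v. v \<in> B \<Longrightarrow> v \<notin> Z \<Longrightarrow> wreg (poly_supported (hits (insert v Z))) fs" "B \<inter> Z = {}"
  shows "wreg (poly_supported (hits Z \<union> covers B)) fs"
  using finite[of B] assms
proof (induction B rule: finite_induct)
  case empty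
  have "poly_supported (hits Z \<union> covers {}) = (UNIV :: ('n, 'k) mpoly set)" by (auto simp: poly_supported_def)
  then show ?case by (simp add: wreg_UNIV)
next
  case (insert v B)
  show ?case
  proof (rule wreg_poly_supported_extension[of _ v])
    show "up_closed (hits Z \<union> covers (insert v B))"
      by (intro up_closed_Un up_closed_hits up_closed_covers)
    have "{m. chi {v} + m \<in> hits Z \<union> covers (insert v B)} = hits Z \<union> covers B"
      using insert by (auto simp: keys_nat_add)
    then show "wreg (poly_supported {m. chi {v} + m \<in> hits Z \<union> covers (insert v B)}) fs"
      using insert by simp
    have "{m. v \<in> keys m} \<union> (hits Z \<union> covers (insert v B)) = hits (insert v Z)" by auto
    then show "wreg (poly_supported ({m. v \<in> keys m} \<union> (hits Z \<union> covers (insert v B)))) fs"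
      using insert.prems by simp
  qed
qed

text \<open>Any other set of the same size as the complement of \<open>Z\<close> meets
  \<open>Z\<close>, so a single term survives the reduction.\<close>

lemma esym_mod_hits:
  "(esym (card (- Z)) - mon (chi (- Z)) :: ('n::finite, 'k::field) mpoly) \<in> poly_supported (hits Z)"
proof -
  have "(esym (card (- Z)) :: ('n, 'k) mpoly) = mon (chi (- Z)) + (\<Sum>B\<in>{B. card B = card (- Z)} - {- Z}. mon (chi B))"
    unfolding esym_def by (rule sum.remove) auto
  moreover have "B \<inter> Z \<noteq> {}" if "card B = card (- Z)" "B \<noteq> - Z" for B
    using that card_subset_eq[of "- Z" B] by auto
  then have "(\<Sum>B\<in>{B. card B = card (- Z)} - {- Z}. mon (chi B) :: ('n, 'k) mpoly) \<in> poly_supported (hits Z)"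
    by (intro ideal.subspace_sum subspace_poly_supported up_closed_hits) auto
  ultimately show ?thesis by simp
qed

lemma span_insert_cong:
  assumes "f - g \<in> J" shows "ideal.span (insert f J) = ideal.span (insert g J)"
proof -
  have "f = g + (f - g)" "g = f - (f - g)" by simp_all
  then have "f \<in> ideal.span (insert g J)" "g \<in> ideal.span (insert f J)"
    using assms by (metis ideal.span_add ideal.span_diff ideal.span_base insertCI)+
  then show ?thesis by (intro ideal.span_eq[THEN iffD2]) (auto intro: ideal.span_base)
qed

text \<open>A spare free variable can be divided out, since it is regular modulo \<open>Z\<close>
  and the entries are homogeneous. Once only \<open>Suc s\<close> variables are free, the leading
  entry is their product modulo \<open>Z\<close>, and the quotient by it is filtered by rings with
  \<open>s\<close> free variables, on which the shorter list is regular.\<close>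

lemma wreg_hits_esyms:
  fixes Z :: "'n::finite set"
  shows "card (- Z) \<ge> s \<Longrightarrow> wreg (poly_supported (hits Z)) (esyms s :: ('n, 'k::field) mpoly list)"
proof (induction s arbitrary: Z)
  case (Suc s)
  note IH_s = Suc.IH
  from Suc.prems show ?case
  proof (induction "card (- Z)" arbitrary: Z)
    case (Suc k)
    let ?J = "poly_supported (hits Z) :: ('n, 'k) mpoly set"
    have sub: "ideal.subspace ?J" by (rule subspace_poly_supported) (rule up_closed_hits)
    show ?case
    proof (cases "k = s")
      case True
      then have card: "card (- Z) = Suc s" using Suc.hyps by simp
      let ?e = "esym (Suc s) :: ('n, 'k) mpoly" and ?m = "mon (chi (- Z)) :: ('n, 'k) mpoly"
      have e: "?e - ?m \<in> ?J" using esym_mod_hits[of Z] card by simp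
      have "g \<in> ?J" if "?e * g \<in> ?J" for g
      proof -
        have "?m * g = ?e * g - g * (?e - ?m)" by (simp add: algebra_simps)
        also have "\<dots> \<in> ?J"
          by (intro ideal.subspace_diff ideal.subspace_scale that e sub)
        finally show ?thesis
          by (auto simp: poly_supported_def keys_mon_times image_subset_iff keys_nat_add Int_Un_distrib2)
      qed
      moreover have "wreg (poly_supported (hits Z \<union> covers (- Z))) (esyms s :: ('n, 'k) mpoly list)"
      proof (rule wreg_hits_covers)
        fix v assume v: "v \<notin> Z"
        have "card (- insert v Z) = s" using card v by (simp add: Compl_insert)
        then show "wreg (poly_supported (hits (insert v Z))) (esyms s :: ('n, 'k) mpoly list)"
          by (intro IH_s) simp
      qed simp
      ultimately show ?thesis
        by (simp add: span_insert_cong[OF e] span_insert_mon[OF up_closed_hits] chi_add_iff Un_commute)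
    next
      case False
      then have "k \<ge> Suc s" using Suc by simp
      obtain v where v: "v \<notin> Z" using Suc.hyps(2) by (metis ComplD card.empty equals0I nat.distinct(1))
      have "card (- insert v Z) = k" using Suc.hyps v by (simp add: Compl_insert)
      then have IH: "wreg (poly_supported (hits (insert v Z))) (esyms (Suc s) :: ('n, 'k) mpoly list)"
        using \<open>k \<ge> Suc s\<close> Suc.hyps(1)[of "insert v Z"] by simp
      show ?thesis
      proof (rule wreg_of_wreg_mod_Var[OF sub truncation_closed_poly_supported homogeneous_esyms])
        show "g \<in> ?J" if "Var v * g \<in> ?J" for g
          using that v by (auto simp: Var_eq poly_supported_def keys_mon_times image_subset_iff keys_nat_add Int_Un_distrib2)
        have "{m. v \<in> keys m} \<union> hits Z = hits (insert v Z)" by auto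
        then show "wreg (ideal.span (insert (Var v) ?J)) (esyms (Suc s) :: ('n, 'k) mpoly list)"
          using IH by (simp add: span_insert_Var[OF up_closed_hits])
      qed
    qed
  qed simp
qed simp

section \<open>A Koszul complex on lists\<close>

text \<open>
  Cochains of degree \<open>i\<close> are functions on lists of length \<open>i\<close>, and
  \<open>koszul \<omega> \<phi> [v\<^sub>0, \<dots>, v\<^sub>i]\<close> is \<open>\<Sum>j. (-1)\<^sup>j * \<omega> v\<^sub>j * \<phi> [v\<^sub>0, \<dots>, v\<^sub>j\<^sub>-\<^sub>1, v\<^sub>j\<^sub>+\<^sub>1, \<dots>, v\<^sub>i]\<close>. Cochains are not required to be
  alternating, which allows the definition by recursion on the list.
\<close>

fun koszul :: "('v \<Rightarrow> 'a::comm_ring_1) \<Rightarrow> ('v list \<Rightarrow> 'a) \<Rightarrow> 'v list \<Rightarrow> 'a" where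
  "koszul \<omega> \<phi> [] = 0"
| "koszul \<omega> \<phi> (v # l) = \<omega> v * \<phi> l - koszul \<omega> (\<lambda>l. \<phi> (v # l)) l"

lemma koszul_diff: "koszul \<omega> (\<lambda>l. \<phi> l - \<psi> l) l = koszul \<omega> \<phi> l - koszul \<omega> \<psi> l"
  by (induction l arbitrary: \<phi> \<psi>) (simp_all add: algebra_simps)

lemma koszul_scale: "koszul \<omega> (\<lambda>l. c * \<phi> l) l = c * koszul \<omega> \<phi> l"
  by (induction l arbitrary: \<phi>) (simp_all add: algebra_simps)

lemma koszul_zero: "koszul \<omega> (\<lambda>l. 0) l = 0"
  using koszul_scale[of \<omega> 0 "\<lambda>l. 0" l] by simp

lemma koszul_add: "koszul \<omega> (\<lambda>l. \<phi> l + \<psi> l) l = koszul \<omega> \<phi> l + koszul \<omega> \<psi> l"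
  by (induction l arbitrary: \<phi> \<psi>) (simp_all add: algebra_simps)

lemma koszul_sum: "koszul \<omega> (\<lambda>l. \<Sum>a\<in>A. \<phi> a l) l = (\<Sum>a\<in>A. koszul \<omega> (\<phi> a) l)"
  by (induction A rule: infinite_finite_induct) (simp_all add: koszul_zero koszul_add)

lemma koszul_sum_left: "koszul (\<lambda>v. \<Sum>a\<in>A. \<omega> a v) \<phi> l = (\<Sum>a\<in>A. koszul (\<omega> a) \<phi> l)"
  by (induction l arbitrary: \<phi>) (simp_all add: sum_distrib_right sum_subtractf)

lemma koszul_koszul: "koszul \<omega> (koszul \<omega> \<phi>) l = 0"
proof (induction l arbitrary: \<phi>)
  case (Cons v l)
  show ?case by (simp add: koszul_diff koszul_scale Cons.IH)
qed simp

lemma koszul_anticommute: "koszul \<omega> (koszul \<eta> \<phi>) l = - koszul \<eta> (koszul \<omega> \<phi>) l"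
proof (induction l arbitrary: \<phi>)
  case (Cons v l)
  show ?case by (simp add: koszul_diff koszul_scale Cons.IH algebra_simps)
qed simp

text \<open>Only an additive subgroup is asked for, not an ideal, so that \<open>W\<close> may also
  consist of the polynomials in which one given coefficient vanishes.\<close>

lemma koszul_mem:
  assumes "0 \<in> W" "\<And>a b. a \<in> W \<Longrightarrow> b \<in> W \<Longrightarrow> a - b \<in> W"
    and "\<And>xs v ys. l = xs @ v # ys \<Longrightarrow> \<omega> v * \<phi> (xs @ ys) \<in> W"
  shows "koszul \<omega> \<phi> l \<in> W"
  using assms(3)
proof (induction l arbitrary: \<phi>)
  case Nil
  show ?case using assms(1) by simp
next
  case (Cons v l)
  have "koszul \<omega> (\<lambda>l. \<phi> (v # l)) l \<in> W"
    by (rule Cons.IH) (use Cons.prems[of "v # _"] in simp)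
  then show ?case using Cons.prems[of "[]" v l] assms(2) by simp
qed

lemma koszul_eq_0: "(\<And>v. v \<in> set l \<Longrightarrow> \<omega> v = 0) \<Longrightarrow> koszul \<omega> \<phi> l = 0"
  using koszul_mem[of "{0}" l \<omega> \<phi>] by simp

lemma mem_max_graded_ideal:
  assumes "f \<in> max_graded_ideal"
  obtains c where "f = (\<Sum>v\<in>UNIV. c v * Var v)"
proof -
  have "\<exists>c. f = (\<Sum>v\<in>UNIV. c v * Var v)"
    using assms unfolding max_graded_ideal_def
  proof (induction rule: ideal.span_induct_alt)
    case base
    show ?case by (rule exI[of _ "\<lambda>_. 0"]) simp
  next
    case (step a x f)
    then obtain v c where "x = Var v" "f = (\<Sum>v\<in>UNIV. c v * Var v)" by blast
    then have "a * x + f = (\<Sum>u\<in>UNIV. (c u + (if u = v then a else 0)) * Var u)"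
      by (simp add: distrib_right sum.distrib if_distrib[of "\<lambda>x. x * _"] cong: if_cong)
    then show ?case by (intro exI)
  qed
  then show ?thesis using that by blast
qed

text \<open>The vanishing of the \<open>i\<close>-th cohomology of \<open>S/J\<close>; \<open>koszul Var \<psi> [] = 0\<close> makes this right for \<open>i = 0\<close>.\<close>

definition koszul_acyclic :: "nat \<Rightarrow> ('n::finite, 'k::field) mpoly set \<Rightarrow> bool" where
  "koszul_acyclic i J \<longleftrightarrow> (\<forall>\<phi>. (\<forall>l. length l = Suc i \<longrightarrow> koszul Var \<phi> l \<in> J) \<longrightarrow>
     (\<exists>\<psi>. \<forall>l. length l = i \<longrightarrow> \<phi> l - koszul Var \<psi> l \<in> J))"

text \<open>Multiplication by an element of the graded maximal ideal is null-homotopic on the Koszul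
  complex. For a regular \<open>f\<close> the long exact sequence then exhibits the cohomology of
  S/J in degree i as a quotient of that of S/(J + (f)) in degree i - 1, which vanishes by induction.
  The proof carries this out on cochains.\<close>

lemma wreg_imp_koszul_acyclic:
  assumes "ideal.subspace J" "wreg J fs" "set fs \<subseteq> max_graded_ideal" "i < length fs"
  shows "koszul_acyclic i J"
  using assms
proof (induction fs arbitrary: i J)
  case (Cons f fs)
  note J = Cons.prems(1)
  have reg: "g \<in> J" if "f * g \<in> J" for g using Cons.prems(2) that by simp
  obtain c where f: "f = (\<Sum>v\<in>UNIV. c v * Var v)"
    using Cons.prems(3) mem_max_graded_ideal by (metis list.set_intros(1) subsetD)
  show ?case unfolding koszul_acyclic_def
  proof (intro allI impI)
    fix \<phi> assume cocycle: "\<forall>l. length l = Suc i \<longrightarrow> koszul Var \<phi> l \<in> J"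
    \<comment> \<open>Contraction with the coefficients of \<open>f\<close>: this is the homotopy
      between multiplication by \<open>f\<close> and zero.\<close>
    define \<eta> where "\<eta> = (\<lambda>l. \<Sum>v\<in>UNIV. c v * \<phi> (v # l))"
    have homotopy: "f * \<phi> l - koszul Var \<eta> l \<in> J" if "length l = i" for l
    proof -
      have "koszul Var \<eta> l = (\<Sum>v\<in>UNIV. c v * koszul Var (\<lambda>l. \<phi> (v # l)) l)"
        by (simp add: \<eta>_def koszul_sum koszul_scale)
      then have "f * \<phi> l - koszul Var \<eta> l = (\<Sum>v\<in>UNIV. c v * koszul Var \<phi> (v # l))"
        by (simp add: f sum_distrib_right right_diff_distrib sum_subtractf mult.assoc)
      also have "\<dots> \<in> J"
        by (intro ideal.subspace_sum[OF J] ideal.subspace_scale[OF J] cocycle[rule_format]) (simp add: that)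
      finally show ?thesis .
    qed
    show "\<exists>\<psi>. \<forall>l. length l = i \<longrightarrow> \<phi> l - koszul Var \<psi> l \<in> J"
    proof (cases i)
      case 0
      then have "\<phi> [] \<in> J" using homotopy[of "[]"] reg by simp
      then show ?thesis using 0 by auto
    next
      case (Suc i')
      have "koszul_acyclic i' (ideal.span (insert f J))"
        using Cons.prems Suc by (intro Cons.IH) auto
      moreover have "koszul Var \<eta> l \<in> ideal.span (insert f J)" if "length l = Suc i'" for l
      proof -
        have "koszul Var \<eta> l = - (f * \<phi> l - koszul Var \<eta> l) + f * \<phi> l" by simp
        then show ?thesis
          using homotopy[of l] that Suc J ideal.subspace_neg mem_span_insert[OF J] by metis
      qed
      ultimately obtain \<psi> where \<psi>: "\<And>l. length l = i' \<Longrightarrow> \<eta> l - koszul Var \<psi> l \<in> ideal.span (insert f J)"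
        unfolding koszul_acyclic_def by blast
      \<comment> \<open>\<open>\<eta>\<close> is a coboundary only modulo J + (f). The cofactors of
        \<open>f\<close> are collected in \<open>\<tau>\<close>; applying the differential and
        cancelling \<open>f\<close> shows that \<open>\<phi>\<close> is the coboundary of
        \<open>\<tau>\<close> modulo \<open>J\<close>.\<close>
      then have "\<exists>t. \<eta> l - koszul Var \<psi> l - f * t \<in> J" if "length l = i'" for l
        using that mem_span_insert[OF J] by (metis add_diff_cancel_right')
      then obtain \<tau> where \<tau>: "\<And>l. length l = i' \<Longrightarrow> \<eta> l - koszul Var \<psi> l - f * \<tau> l \<in> J"
        by metis
      have "\<phi> l - koszul Var \<tau> l \<in> J" if l: "length l = i" for l
      proof -
        have "koszul Var (\<lambda>l. \<eta> l - koszul Var \<psi> l - f * \<tau> l) l \<in> J"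
          using \<tau> Suc l J
          by (intro koszul_mem) (auto simp: ideal.subspace_0 ideal.subspace_diff ideal.subspace_scale)
        then have "koszul Var \<eta> l - f * koszul Var \<tau> l \<in> J"
          by (simp add: koszul_diff koszul_scale koszul_koszul)
        then have "(f * \<phi> l - koszul Var \<eta> l) + (koszul Var \<eta> l - f * koszul Var \<tau> l) \<in> J"
          using homotopy[OF l] J by (intro ideal.subspace_add)
        then show ?thesis by - (rule reg, simp add: algebra_simps)
      qed
      then show ?thesis by blast
    qed
  qed
qed simp

section \<open>Bounds for the depth\<close>

lemma one_not_in_max_graded_ideal: "1 \<notin> max_graded_ideal"
  by (simp add: max_graded_ideal_eq poly_supported_def)

lemma depth_quot_ge:
  assumes "ideal.subspace J" "J \<subseteq> max_graded_ideal" "set fs \<subseteq> max_graded_ideal" "wreg J fs"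
  shows "depth_quot J \<ge> length fs"
proof -
  have "ideal.span (J \<union> set fs) \<subseteq> max_graded_ideal"
    using assms(2,3) by (intro ideal.span_minimal) (simp_all add: max_graded_ideal_def)
  then have "ideal.span (J \<union> set fs) \<noteq> UNIV" using one_not_in_max_graded_ideal by blast
  then have "regular_sequence_mod J fs"
    using assms wreg_iff unfolding regular_sequence_mod_def by blast
  then show ?thesis unfolding depth_quot_def using assms(3) by (intro Sup_upper) blast
qed

lemma depth_quot_le:
  assumes "ideal.subspace J" "\<not> koszul_acyclic i J"
  shows "depth_quot J \<le> i"
  unfolding depth_quot_def
proof (rule Sup_least)
  fix x assume "x \<in> {enat (length fs) |fs. set fs \<subseteq> max_graded_ideal \<and> regular_sequence_mod J fs}"
  then obtain fs where fs: "x = length fs" "set fs \<subseteq> max_graded_ideal" "regular_sequence_mod J fs"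
    by blast
  then have "wreg J fs" using wreg_iff[OF assms(1)] unfolding regular_sequence_mod_def by blast
  then have "length fs \<le> i"
    using wreg_imp_koszul_acyclic[OF assms(1)] fs(2) assms(2) not_le by blast
  then show "x \<le> i" using fs(1) by simp
qed

section \<open>Koszul cohomology classes from colorings of the variables\<close>

text \<open>In exterior notation this is the monomial \<open>u\<close> times the wedge product over
  the colors c in the list of the one-forms that sum x_v e_v over the variables v of color
  c.\<close>

fun color_cochain :: "('n \<Rightarrow> 'c) \<Rightarrow> ('n::finite \<Rightarrow>\<^sub>0 nat) \<Rightarrow> 'c list \<Rightarrow> 'n list \<Rightarrow> ('n, 'k::field) mpoly" where
  "color_cochain col u [] = (\<lambda>l. if l = [] then mon u else 0)"
| "color_cochain col u (c # cs) =
     koszul (\<lambda>v. if col v = c then Var v else 0) (color_cochain col u cs)"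

lemma color_cochain_support:
  fixes col :: "'n::finite \<Rightarrow> 'c"
  shows "(color_cochain col u cs l :: ('n, 'k::field) mpoly) \<in> poly_supported {u + m | m. set cs \<subseteq> col ` keys m}"
proof (induction cs arbitrary: l)
  case Nil
  show ?case by (auto simp: poly_supported_def intro: exI[of _ 0])
next
  case (Cons c cs)
  show ?case unfolding color_cochain.simps
  proof (rule koszul_mem)
    fix a b :: "('n, 'k) mpoly"
    assume "a \<in> poly_supported {u + m | m. set (c # cs) \<subseteq> col ` keys m}"
      "b \<in> poly_supported {u + m | m. set (c # cs) \<subseteq> col ` keys m}"
    then show "a - b \<in> poly_supported {u + m | m. set (c # cs) \<subseteq> col ` keys m}"
      using keys_diff[of a b] by (fastforce simp: poly_supported_def)
  next
    fix xs v ys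
    let ?p = "color_cochain col u cs (xs @ ys) :: ('n, 'k) mpoly"
    have "Var v * ?p \<in> poly_supported {u + m | m. set (c # cs) \<subseteq> col ` keys m}" if v: "col v = c"
    proof -
      have "chi {v} + m \<in> {u + m | m. set (c # cs) \<subseteq> col ` keys m}" if m: "m \<in> keys ?p" for m
      proof -
        obtain m' where m': "m = u + m'" "set cs \<subseteq> col ` keys m'"
          using Cons[of "xs @ ys"] m unfolding poly_supported_def by blast
        then have "chi {v} + m = u + (chi {v} + m')" by (simp add: ac_simps)
        moreover have "set (c # cs) \<subseteq> col ` keys (chi {v} + m')"
          using m' v by (auto simp: keys_nat_add)
        ultimately show ?thesis by blast
      qed
      then show ?thesis by (auto simp: Var_eq poly_supported_def keys_mon_times)
    qed
    then show "(if col v = c then Var v else 0) * ?p \<in> poly_supported {u + m | m. set (c # cs) \<subseteq> col ` keys m}"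
      by (simp add: poly_supported_def)
  qed (simp add: poly_supported_def)
qed

text \<open>The one-form of a color squares to zero, and anticommutation brings the new factor next
  to its copy in the product.\<close>

lemma color_cochain_killed:
  fixes col :: "'n::finite \<Rightarrow> 'c"
  shows "c \<in> set cs \<Longrightarrow>
    koszul (\<lambda>v. if col v = c then Var v else 0 :: ('n, 'k::field) mpoly) (color_cochain col u cs) l = 0"
proof (induction cs arbitrary: l)
  case (Cons c' cs)
  show ?case
  proof (cases "c = c'")
    case False
    then have "koszul (\<lambda>v. if col v = c then Var v else 0 :: ('n, 'k) mpoly) (color_cochain col u cs) = (\<lambda>l. 0)"
      using Cons by (intro ext) simp
    then show ?thesis
      by (simp add: koszul_anticommute[of "\<lambda>v. if col v = c then Var v else 0"] koszul_zero)
  qed (simp add: koszul_koszul)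
qed simp

text \<open>With one variable per color in the order of the list, each color can only be matched
  with its own variable, so a single term survives, with sign +1.\<close>

lemma color_cochain_transversal:
  fixes col :: "'n::finite \<Rightarrow> 'c"
  shows "distinct (map col vs) \<Longrightarrow>
    (color_cochain col u (map col vs) vs :: ('n, 'k::field) mpoly) = mon (u + (\<Sum>v\<leftarrow>vs. chi {v}))"
proof (induction vs)
  case (Cons v vs)
  let ?\<phi> = "color_cochain col u (map col vs) :: 'n list \<Rightarrow> ('n, 'k) mpoly"
  have "koszul (\<lambda>w. if col w = col v then Var w else 0) (\<lambda>l. ?\<phi> (v # l)) vs = 0"
    using Cons.prems by (intro koszul_eq_0) (auto simp: image_iff)
  then show ?case using Cons by (simp add: Var_eq mon_mult ac_simps)
qed simp

text \<open>
  The class of \<open>color_cochain col u cs\<close>, where \<open>cs\<close> lists all colors but one, does not vanish: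
  the coefficients of the monomials \<open>u\<close> times a transversal of the colors see the top cohomology
  class of the boundary of a simplex.
\<close>

lemma depth_quot_le_colors:
  fixes U :: "('n::finite \<Rightarrow>\<^sub>0 nat) set" and col :: "'n \<Rightarrow> 'c"
  assumes U: "up_closed U" and u: "\<And>m. u + m \<in> U \<longleftrightarrow> range col \<subseteq> col ` keys m"
  shows "depth_quot (poly_supported U :: ('n, 'k::field) mpoly set) \<le> card (range col) - 1"
proof -
  let ?J = "poly_supported U :: ('n, 'k) mpoly set"
  let ?Y = "\<lambda>c v. if col v = c then Var v else 0 :: ('n, 'k) mpoly"
  have J: "ideal.subspace ?J" using U by (rule subspace_poly_supported)
  obtain cs0 where cs0: "set cs0 = range col" "distinct cs0"
    using finite_distinct_list[of "range col"] by auto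
  then obtain c cs where cs: "cs0 = c # cs" by (cases cs0) simp_all
  then have range: "range col = insert c (set cs)" and c: "c \<notin> set cs" using cs0 by auto
  have len: "length cs = card (range col) - 1" using cs cs0 distinct_card by fastforce
  let ?\<phi> = "color_cochain col u cs :: 'n list \<Rightarrow> ('n, 'k) mpoly"
  have Var_sum: "Var = (\<lambda>v. \<Sum>a\<in>range col. ?Y a v)" by (intro ext) (simp add: sum.delta)
  \<comment> \<open>The Koszul differential is the sum of its colored parts. Those for colors
    already in \<open>cs\<close> vanish on the cochain, so only the omitted color \<open>c\<close>
    contributes.\<close>
  have d\<phi>: "koszul Var ?\<phi> l = color_cochain col u (c # cs) l" for l
  proof -
    have "koszul Var ?\<phi> l = (\<Sum>a\<in>range col. koszul (?Y a) ?\<phi> l)"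
      by (subst Var_sum) (rule koszul_sum_left)
    also have "\<dots> = koszul (?Y c) ?\<phi> l + (\<Sum>a\<in>set cs. koszul (?Y a) ?\<phi> l)"
      using c by (simp add: range)
    also have "(\<Sum>a\<in>set cs. koszul (?Y a) ?\<phi> l) = 0"
      by (rule sum.neutral) (simp add: color_cochain_killed)
    finally show ?thesis by simp
  qed
  have "\<not> koszul_acyclic (length cs) ?J"
  proof
    assume acyclic: "koszul_acyclic (length cs) ?J"
    have "koszul Var ?\<phi> l \<in> ?J" for l
    proof -
      have "{u + m | m. set (c # cs) \<subseteq> col ` keys m} \<subseteq> U" using u range by auto
      then show ?thesis
        using color_cochain_support[of col u "c # cs" l] unfolding d\<phi> poly_supported_def by blast
    qed
    then obtain \<psi> where \<psi>: "\<And>l. length l = length cs \<Longrightarrow> ?\<phi> l - koszul Var \<psi> l \<in> ?J"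
      using acyclic unfolding koszul_acyclic_def by blast
    obtain vs where vs: "map col vs = c # cs"
      using range ex_map_conv[of "c # cs" col] by (metis list.simps(15) rangeE)
    have dist: "distinct (map col vs)" using vs cs cs0 by simp
    let ?m = "u + (\<Sum>v\<leftarrow>vs. chi {v})"
    \<comment> \<open>One coefficient suffices for the contradiction. Deleting v from
      \<open>vs\<close> loses its color, so the remaining exponent is outside \<open>U\<close> and
      elements of \<open>?J\<close> have coefficient 0 there. The differential of
      \<open>?\<phi>\<close>, however, has coefficient 1 at \<open>?m\<close>.\<close>
    let ?W = "{p :: ('n, 'k) mpoly. lookup p ?m = 0}"
    have "koszul Var (\<lambda>l. ?\<phi> l - koszul Var \<psi> l) vs \<in> ?W"
    proof (rule koszul_mem)
      fix xs v ys assume split: "vs = xs @ v # ys"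
      let ?p = "?\<phi> (xs @ ys) - koszul Var \<psi> (xs @ ys)"
      let ?m' = "u + (\<Sum>v\<leftarrow>xs @ ys. chi {v})"
      have keys: "keys (\<Sum>v\<leftarrow>zs. chi {v}) = set zs" for zs :: "'n list"
        by (induction zs) (simp_all add: keys_nat_add)
      have "col v \<notin> col ` set (xs @ ys)" using dist split by auto
      then have "\<not> range col \<subseteq> col ` keys (\<Sum>v\<leftarrow>xs @ ys. chi {v})" unfolding keys by blast
      then have "?m' \<notin> U" using u by blast
      moreover have "length (xs @ ys) = length cs" using arg_cong[OF vs, of length] split by simp
      ultimately have "lookup ?p ?m' = 0"
        using \<psi>[of "xs @ ys"] by (auto simp: poly_supported_def in_keys_iff)
      moreover have "?m = chi {v} + ?m'" by (simp add: split ac_simps)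
      ultimately show "Var v * ?p \<in> ?W" by (simp add: Var_eq lookup_mon_times)
    qed (simp_all add: lookup_minus)
    moreover have "koszul Var (\<lambda>l. ?\<phi> l - koszul Var \<psi> l) vs = mon ?m"
      using color_cochain_transversal[OF dist, of u] vs by (simp add: koszul_diff koszul_koszul d\<phi>)
    ultimately show False by (simp add: mon_def)
  qed
  then show ?thesis using depth_quot_le[OF J] len by simp
qed

section \<open>Products of monomial ideals\<close>

lemma prod_mon: "(\<Prod>i\<in>F. mon (g i)) = (mon (\<Sum>i\<in>F. g i) :: ('n, 'k::field) mpoly)"
  by (induction F rule: infinite_finite_induct) (simp_all add: mon_zero mon_mult)

lemma mult_mem_span_mon:
  fixes p q :: "('n::finite, 'k::field) mpoly"
  assumes "p \<in> ideal.span (mon ` A)" "q \<in> ideal.span (mon ` B)"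
  shows "p * q \<in> ideal.span (mon ` {a + b | a b. a \<in> A \<and> b \<in> B})"
  unfolding span_mon poly_supported_def
proof (intro CollectI subsetI)
  fix m assume "m \<in> keys (p * q)"
  then obtain s t where st: "m = s + t" "s \<in> keys p" "t \<in> keys q" using keys_mult[of p q] by blast
  then obtain a b c e where "a \<in> A" "b \<in> B" "s = a + c" "t = b + e"
    using keys_span_mon[OF assms(1)] keys_span_mon[OF assms(2)] by metis
  moreover from this have "m = (a + b) + (c + e)" using st by (simp add: ac_simps)
  ultimately show "m \<in> up_closure {a + b | a b. a \<in> A \<and> b \<in> B}"
    unfolding up_closure_def by blast
qed

lemma prod_ideals_span_mon:
  fixes G :: "'i \<Rightarrow> ('n::finite \<Rightarrow>\<^sub>0 nat) set"
  assumes "finite F"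
  shows "prod_ideals (\<lambda>i. ideal.span (mon ` G i)) F =
    (ideal.span (mon ` {\<Sum>i\<in>F. g i | g. \<forall>i\<in>F. g i \<in> G i}) :: ('n, 'k::field) mpoly set)"
  unfolding prod_ideals_def
proof (intro ideal.span_eq[THEN iffD2] conjI subsetI)
  fix p :: "('n, 'k) mpoly"
  assume "p \<in> {\<Prod>i\<in>F. f i |f. \<forall>i\<in>F. f i \<in> ideal.span (mon ` G i)}"
  then obtain f where f: "p = (\<Prod>i\<in>F. f i)" "\<forall>i\<in>F. f i \<in> ideal.span (mon ` G i)" by blast
  from assms f(2) have "(\<Prod>i\<in>F. f i) \<in> ideal.span (mon ` {\<Sum>i\<in>F. g i | g. \<forall>i\<in>F. g i \<in> G i})"
  proof (induction F)
    case empty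
    have "(1 :: ('n, 'k) mpoly) \<in> mon ` {0}" by (simp add: mon_zero)
    then show ?case by (simp add: ideal.span_base)
  next
    case (insert j F)
    have "{a + b | a b. a \<in> G j \<and> b \<in> {\<Sum>i\<in>F. g i | g. \<forall>i\<in>F. g i \<in> G i}} \<subseteq>
        {\<Sum>i\<in>insert j F. g i | g. \<forall>i\<in>insert j F. g i \<in> G i}"
    proof clarify
      fix a and g assume ag: "a \<in> G j" "\<forall>i\<in>F. g i \<in> G i"
      have "(\<Sum>i\<in>F. (g(j := a)) i) = sum g F" using insert by (intro sum.cong) auto
      then have "a + sum g F = (\<Sum>i\<in>insert j F. (g(j := a)) i)" using insert by simp
      moreover have "\<forall>i\<in>insert j F. (g(j := a)) i \<in> G i" using ag by simp
      ultimately show "\<exists>h. a + sum g F = (\<Sum>i\<in>insert j F. h i) \<and> (\<forall>i\<in>insert j F. h i \<in> G i)"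
        by blast
    qed
    moreover have "f j * prod f F \<in> ideal.span (mon ` {a + b | a b. a \<in> G j \<and>
        b \<in> {\<Sum>i\<in>F. g i | g. \<forall>i\<in>F. g i \<in> G i}})"
      using insert by (intro mult_mem_span_mon) auto
    ultimately have "f j * prod f F \<in> ideal.span (mon ` {\<Sum>i\<in>insert j F. g i | g. \<forall>i\<in>insert j F. g i \<in> G i})"
      by (rule ideal.span_mono[OF image_mono, THEN subsetD])
    then show ?case using insert(1,2) by simp
  qed
  then show "p \<in> ideal.span (mon ` {\<Sum>i\<in>F. g i | g. \<forall>i\<in>F. g i \<in> G i})" using f(1) by simp
next
  fix p :: "('n, 'k) mpoly" assume "p \<in> mon ` {\<Sum>i\<in>F. g i | g. \<forall>i\<in>F. g i \<in> G i}"
  then obtain g where "p = (\<Prod>i\<in>F. mon (g i))" "\<forall>i\<in>F. g i \<in> G i" by (auto simp: prod_mon)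
  moreover from this have "\<forall>i\<in>F. mon (g i) \<in> (ideal.span (mon ` G i) :: ('n, 'k) mpoly set)"
    by (simp add: ideal.span_base)
  ultimately show "p \<in> ideal.span {\<Prod>i\<in>F. f i |f. \<forall>i\<in>F. f i \<in> ideal.span (mon ` G i)}"
    by (intro ideal.span_base) blast
qed

text \<open>The exponents of the products of k generators. Keeping exact sums, without closing
  upwards, preserves the degree on each component.\<close>

primrec nsum :: "('n \<Rightarrow>\<^sub>0 nat) set \<Rightarrow> nat \<Rightarrow> ('n \<Rightarrow>\<^sub>0 nat) set" where
  "nsum G 0 = {0}"
| "nsum G (Suc k) = {g + w | g w. g \<in> G \<and> w \<in> nsum G k}"

lemma nsum_add: "w \<in> nsum G k \<Longrightarrow> w' \<in> nsum G l \<Longrightarrow> w + w' \<in> nsum G (k + l)"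
proof (induction k arbitrary: w)
  case (Suc k)
  then obtain g w'' where "g \<in> G" "w'' \<in> nsum G k" "w = g + w''" by auto
  moreover from this Suc have "w'' + w' \<in> nsum G (k + l)" by simp
  ultimately show ?case by (auto simp: add.assoc)
qed simp

lemma nsum_1: "g \<in> G \<Longrightarrow> g \<in> nsum G 1"
  by simp

lemma nsum_sum:
  "finite F \<Longrightarrow> (\<And>i. i \<in> F \<Longrightarrow> w i \<in> nsum G (k i)) \<Longrightarrow> (\<Sum>i\<in>F. w i) \<in> nsum G (\<Sum>i\<in>F. k i)"
  by (induction F rule: finite_induct) (auto intro: nsum_add)

lemma sums_eq_nsum: "{\<Sum>i\<in>{1..k}. g i | g. \<forall>i\<in>{1..k}. g i \<in> G} = nsum G k"
proof (induction k)
  case (Suc k)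
  have split: "{1..Suc k} = insert (Suc k) {1..k}" by auto
  show ?case
  proof (intro equalityI subsetI)
    fix w assume "w \<in> {\<Sum>i\<in>{1..Suc k}. g i | g. \<forall>i\<in>{1..Suc k}. g i \<in> G}"
    then obtain g where g: "w = (\<Sum>i\<in>{1..Suc k}. g i)" "\<forall>i\<in>{1..Suc k}. g i \<in> G" by blast
    then have "(\<Sum>i\<in>{1..k}. g i) \<in> nsum G k" unfolding Suc[symmetric] by auto
    moreover have "w = g (Suc k) + (\<Sum>i\<in>{1..k}. g i)" unfolding g(1) split by simp
    moreover have "g (Suc k) \<in> G" using g(2) by simp
    ultimately show "w \<in> nsum G (Suc k)" unfolding nsum.simps by blast
  next
    fix w assume "w \<in> nsum G (Suc k)"
    then obtain a g where ag: "w = a + (\<Sum>i\<in>{1..k}. g i)" "a \<in> G" "\<forall>i\<in>{1..k}. g i \<in> G"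
      unfolding nsum.simps Suc[symmetric] by blast
    have "(\<Sum>i\<in>{1..k}. (g(Suc k := a)) i) = (\<Sum>i\<in>{1..k}. g i)" by (intro sum.cong) auto
    then have "w = (\<Sum>i\<in>{1..Suc k}. (g(Suc k := a)) i)" unfolding ag(1) split by simp
    moreover have "\<forall>i\<in>{1..Suc k}. (g(Suc k := a)) i \<in> G" using ag by simp
    ultimately show "w \<in> {\<Sum>i\<in>{1..Suc k}. g i | g. \<forall>i\<in>{1..Suc k}. g i \<in> G}" by blast
  qed
qed simp

lemma power_ideal_span_mon:
  "power_ideal (ideal.span (mon ` G)) k = (ideal.span (mon ` nsum G k) :: ('n::finite, 'k::field) mpoly set)"
  unfolding power_ideal_def prod_ideals_span_mon[OF finite_atLeastAtMost] sums_eq_nsum ..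

definition deg_on :: "'n set \<Rightarrow> ('n::finite \<Rightarrow>\<^sub>0 nat) \<Rightarrow> nat" where
  "deg_on A m = (\<Sum>v\<in>A. lookup m v)"

lemma deg_on_add [simp]: "deg_on A (m + m') = deg_on A m + deg_on A m'"
  by (simp add: deg_on_def lookup_add sum.distrib)

lemma deg_on_zero [simp]: "deg_on A 0 = 0"
  by (simp add: deg_on_def)

lemma deg_on_chi [simp]: "deg_on A (chi B) = card (A \<inter> B)"
  by (simp add: deg_on_def Int_def)

lemma deg_on_pos: "deg_on A m > 0 \<longleftrightarrow> keys m \<inter> A \<noteq> {}"
  by (auto simp: deg_on_def sum_nonneg_eq_0_iff in_keys_iff simp flip: neq0_conv)

lemma deg_on_nsum:
  "(\<And>g. g \<in> G \<Longrightarrow> deg_on A g = e) \<Longrightarrow> w \<in> nsum G k \<Longrightarrow> deg_on A w = k * e"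
  by (induction k arbitrary: w) auto

section \<open>Deletion and contraction\<close>

definition matroid_bases :: "nat \<Rightarrow> 'n set set \<Rightarrow> bool" where
  "matroid_bases r \<B> \<longleftrightarrow> \<B> \<noteq> {} \<and> (\<forall>B\<in>\<B>. card B = r) \<and>
     (\<forall>B\<in>\<B>. \<forall>B'\<in>\<B>. \<forall>i\<in>B - B'. \<exists>j\<in>B' - B. insert j (B - {i}) \<in> \<B>)"

lemma matroid_bases_exchange:
  assumes "matroid_bases r \<B>" "B \<in> \<B>" "B' \<in> \<B>" "i \<in> B" "i \<notin> B'"
  obtains j where "j \<in> B'" "j \<notin> B" "insert j (B - {i}) \<in> \<B>"
  using assms unfolding matroid_bases_def by blast

text \<open>Exchange removes a chosen element but does not insert a chosen one. Insertion of
  \<open>x\<close> is obtained from a basis through \<open>x\<close> with fewest elements outside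
  \<open>B\<close>: another such element besides \<open>x\<close> could be exchanged for one of
  \<open>B\<close>.\<close>

lemma matroid_bases_exchange_into:
  fixes \<B> :: "'n::finite set set"
  assumes "matroid_bases r \<B>" "B \<in> \<B>" "B' \<in> \<B>" "x \<in> B'"
  obtains C where "C \<in> \<B>" "x \<in> C" "C - {x} \<subseteq> B"
proof -
  obtain C where C: "C \<in> \<B>" "x \<in> C"
    and min: "\<And>C'. C' \<in> \<B> \<Longrightarrow> x \<in> C' \<Longrightarrow> card (C - B) \<le> card (C' - B)"
    using ex_has_least_nat[of "\<lambda>C. C \<in> \<B> \<and> x \<in> C" B' "\<lambda>C. card (C - B)"] assms by blast
  have "C - {x} \<subseteq> B"
  proof (rule subsetI, rule ccontr)
    fix i assume i: "i \<in> C - {x}" "i \<notin> B"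
    then obtain j where j: "j \<in> B" "j \<notin> C" "insert j (C - {i}) \<in> \<B>"
      using matroid_bases_exchange[OF assms(1) C(1) assms(2)] by blast
    have "insert j (C - {i}) - B \<subset> C - B" using i j by auto
    then have "card (insert j (C - {i}) - B) < card (C - B)" by (simp add: psubset_card_mono)
    then show False using min[of "insert j (C - {i})"] j i C by auto
  qed
  then show ?thesis using that C by blast
qed

lemma wreg_unit:
  fixes fs :: "('n::finite, 'k::field) mpoly list"
  assumes "0 \<in> U" "up_closed U"
  shows "wreg (poly_supported U) fs"
proof -
  have "U = UNIV" using assms up_closedD[of U 0] by auto
  then have "poly_supported U = (UNIV :: ('n, 'k) mpoly set)" by (simp add: poly_supported_def)
  then show ?thesis by (simp add: wreg_UNIV)
qed

lemma up_closed_UN: "(\<And>a. a \<in> A \<Longrightarrow> up_closed (U a)) \<Longrightarrow> up_closed (\<Union>a\<in>A. U a)"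
  by (auto simp: up_closed_def)

lemma matroid_bases_delete:
  assumes "matroid_bases r \<B>" "\<exists>B\<in>\<B>. x \<notin> B"
  shows "matroid_bases r {B \<in> \<B>. x \<notin> B}"
  unfolding matroid_bases_def
proof (intro conjI ballI)
  fix B B' i assume B: "B \<in> {B \<in> \<B>. x \<notin> B}" "B' \<in> {B \<in> \<B>. x \<notin> B}" "i \<in> B - B'"
  then obtain j where "j \<in> B'" "j \<notin> B" "insert j (B - {i}) \<in> \<B>"
    using matroid_bases_exchange[OF assms(1), of B B' i] by auto
  then show "\<exists>j\<in>B' - B. insert j (B - {i}) \<in> {B \<in> \<B>. x \<notin> B}"
    using B by (intro bexI[of _ j]) auto
qed (use assms in \<open>auto simp: matroid_bases_def\<close>)

lemma matroid_bases_contract: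
  assumes "matroid_bases r \<B>" "\<exists>B\<in>\<B>. x \<in> B"
  shows "matroid_bases (r - 1) {B. x \<notin> B \<and> insert x B \<in> \<B>}"
  unfolding matroid_bases_def
proof (intro conjI ballI)
  obtain B where "B \<in> \<B>" "x \<in> B" using assms by blast
  then have "B - {x} \<in> {B. x \<notin> B \<and> insert x B \<in> \<B>}" by (simp add: insert_absorb)
  then show "{B. x \<notin> B \<and> insert x B \<in> \<B>} \<noteq> {}" by (metis empty_iff)
  fix B assume B: "B \<in> {B. x \<notin> B \<and> insert x B \<in> \<B>}"
  then have "card (insert x B) = r" using assms(1) by (simp add: matroid_bases_def)
  then show "card B = r - 1" using B by (cases "finite B") auto
  fix B' i assume B': "B' \<in> {B. x \<notin> B \<and> insert x B \<in> \<B>}" "i \<in> B - B'"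
  then obtain j where j: "j \<in> insert x B'" "j \<notin> insert x B" "insert j (insert x B - {i}) \<in> \<B>"
    using matroid_bases_exchange[OF assms(1), of "insert x B" "insert x B'" i] B by auto
  moreover have "insert j (insert x B - {i}) = insert x (insert j (B - {i}))" using B B' by auto
  ultimately show "\<exists>j\<in>B' - B. insert j (B - {i}) \<in> {B. x \<notin> B \<and> insert x B \<in> \<B>}"
    using B by (intro bexI[of _ j]) auto
qed

text \<open>\<open>X\<close> contains the ground set, \<open>Z\<close> holds the killed variables,
  all others are free. Contraction trades one unit of rank for one free variable and deletion
  changes neither number, so the bound on \<open>s\<close> persists.\<close>

lemma wreg_matroid:
  fixes \<B> :: "'n::finite set set"
  assumes "matroid_bases r \<B>" "\<Union>\<B> \<subseteq> X" "X \<inter> Z = {}" "Suc s \<le> card (- (X \<union> Z)) + r"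
  shows "wreg (poly_supported (hits Z \<union> (\<Union>B\<in>\<B>. covers B))) (esyms s :: ('n, 'k::field) mpoly list)"
  using assms
proof (induction "card X" arbitrary: X Z \<B> r rule: less_induct)
  case less
  let ?U = "hits Z \<union> (\<Union>B\<in>\<B>. covers B)"
  note M = less.prems(1)
  have U: "up_closed ?U" by (intro up_closed_Un up_closed_UN up_closed_hits up_closed_covers)
  obtain B0 where B0: "B0 \<in> \<B>" "card B0 = r" using M unfolding matroid_bases_def by blast
  show ?case
  proof (cases r)
    case 0
    then have "{} \<in> \<B>" using B0 by simp
    then show ?thesis by (intro wreg_unit U) auto
  next
    case (Suc r')
    then obtain x where x: "x \<in> B0" using B0 by fastforce
    then have xX: "x \<in> X" "x \<notin> Z" using less.prems B0 by auto
    have card: "card (X - {x}) < card X" using xX by (intro psubset_card_mono) auto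
    show ?thesis
    proof (rule wreg_poly_supported_extension[OF U, of x])
      let ?C = "{B. x \<notin> B \<and> insert x B \<in> \<B>}"
      have "{m. chi {x} + m \<in> ?U} = hits Z \<union> (\<Union>B\<in>?C. covers B)"
      proof (intro equalityI subsetI)
        fix m assume m: "m \<in> {m. chi {x} + m \<in> ?U}"
        show "m \<in> hits Z \<union> (\<Union>B\<in>?C. covers B)"
        proof (cases "m \<in> hits Z")
          case False
          then obtain B where B: "B \<in> \<B>" "B - {x} \<subseteq> keys m"
            using m xX by (auto simp: keys_nat_add)
          \<comment> \<open>\<open>B\<close> itself may avoid \<open>x\<close>. A basis through
            \<open>x\<close> whose other elements lie in \<open>B\<close> replaces it, which
            identifies the colon with the ideal of the contraction.\<close>
          then obtain C where C: "C \<in> \<B>" "x \<in> C" "C - {x} \<subseteq> B"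
            using matroid_bases_exchange_into[OF M B(1) B0(1) x] by blast
          then have "C - {x} \<in> ?C" "C - {x} \<subseteq> keys m" using B by (auto simp: insert_absorb)
          then show ?thesis by blast
        qed blast
      next
        fix m assume m: "m \<in> hits Z \<union> (\<Union>B\<in>?C. covers B)"
        then have "m \<in> hits Z \<or> (\<exists>B. insert x B \<in> \<B> \<and> insert x B \<subseteq> keys (chi {x} + m))"
          by (auto simp: keys_nat_add)
        then show "m \<in> {m. chi {x} + m \<in> ?U}" using xX(2) by (fastforce simp: keys_nat_add)
      qed
      moreover have "wreg (poly_supported (hits Z \<union> (\<Union>B\<in>?C. covers B))) (esyms s :: ('n, 'k) mpoly list)"
      proof (rule less.hyps[OF card])
        show "matroid_bases (r - 1) ?C" using matroid_bases_contract[OF M] B0 x by blast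
        show "\<Union>?C \<subseteq> X - {x}" using less.prems(2) by blast
        have "- (X - {x} \<union> Z) = insert x (- (X \<union> Z))" using xX by auto
        then show "Suc s \<le> card (- (X - {x} \<union> Z)) + (r - 1)" using less.prems(4) xX Suc by simp
      qed (use less.prems in auto)
      ultimately show "wreg (poly_supported {m. chi {x} + m \<in> ?U}) (esyms s :: ('n, 'k) mpoly list)"
        by simp
      show "wreg (poly_supported ({m. x \<in> keys m} \<union> ?U)) (esyms s :: ('n, 'k) mpoly list)"
      proof (cases "\<exists>B\<in>\<B>. x \<notin> B")
        case True
        let ?D = "{B \<in> \<B>. x \<notin> B}"
        have "{m. x \<in> keys m} \<union> ?U = hits (insert x Z) \<union> (\<Union>B\<in>?D. covers B)" by auto
        moreover have "wreg (poly_supported (hits (insert x Z) \<union> (\<Union>B\<in>?D. covers B))) (esyms s :: ('n, 'k) mpoly list)"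
        proof (rule less.hyps[OF card])
          show "matroid_bases r ?D" using matroid_bases_delete[OF M True] .
          have "X - {x} \<union> insert x Z = X \<union> Z" using xX by auto
          then show "Suc s \<le> card (- (X - {x} \<union> insert x Z)) + r" using less.prems(4) by simp
        qed (use less.prems xX in auto)
        ultimately show ?thesis by simp
      next
        case False
        \<comment> \<open>Here \<open>x\<close> is a coloop: killing it absorbs all bases, and no
          matroid is left. The other r - 1 elements of \<open>B0\<close> become free and make up for
          the lost rank.\<close>
        then have "{m. x \<in> keys m} \<union> ?U = hits (insert x Z)" by auto
        moreover have "s \<le> card (- insert x Z)"
        proof -
          have "card (B0 - {x}) = r - 1" using B0 x by simp
          moreover have "card ((B0 - {x}) \<union> - (X \<union> Z)) = card (B0 - {x}) + card (- (X \<union> Z))"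
            using less.prems B0 by (intro card_Un_disjoint) auto
          moreover have "card ((B0 - {x}) \<union> - (X \<union> Z)) \<le> card (- insert x Z)"
            using less.prems B0 xX by (intro card_mono) auto
          ultimately show ?thesis using less.prems(4) Suc by simp
        qed
        ultimately show ?thesis by (simp only: wreg_hits_esyms)
      qed
    qed
  qed
qed

section \<open>Powers of products of primes in disjoint sets of variables\<close>

lemma card_le_card_disjoint_Union:
  assumes "finite (\<Union>i\<in>T. A i)" "disjoint_family_on A T" "\<And>i. i \<in> T \<Longrightarrow> A i \<noteq> {}"
  shows "card T \<le> card (\<Union>i\<in>T. A i)"
proof -
  have "\<forall>i\<in>T. \<exists>x. x \<in> A i" using assms(3) by blast
  from bchoice[OF this] obtain f where f: "\<And>i. i \<in> T \<Longrightarrow> f i \<in> A i" by blast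
  then have "inj_on f T" using assms(2) unfolding disjoint_family_on_def inj_on_def by (metis disjoint_iff)
  then show ?thesis using f by (intro card_inj_on_le[OF _ _ assms(1)]) auto
qed

text \<open>The exponent set is that of a product of prime powers. The exponents \<open>k i\<close>
  vary independently because the colon by a variable of \<open>A i\<close> lowers only
  \<open>k i\<close>; killing the variable instead shrinks what is left of
  \<open>A i\<close>.\<close>

lemma wreg_disjoint_product:
  fixes A :: "'i \<Rightarrow> 'n::finite set"
  assumes "finite T" "disjoint_family_on A T" "Suc s \<le> card T" "\<And>i. i \<in> T \<Longrightarrow> A i - Z \<noteq> {}"
  shows "wreg (poly_supported (hits Z \<union> {m. \<forall>i\<in>T. k i \<le> deg_on (A i) m}))
    (esyms s :: ('n, 'k::field) mpoly list)"
  using assms(4)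
proof (induction "(\<Sum>i\<in>T. k i) + card (- Z)" arbitrary: k Z rule: less_induct)
  case less
  let ?V = "\<lambda>k. {m. \<forall>i\<in>T. k i \<le> deg_on (A i) m}"
  have disj: "j = i" if "x \<in> A j" "x \<in> A i" "j \<in> T" "i \<in> T" for x i j
    using that assms(2) unfolding disjoint_family_on_def by blast
  have U: "up_closed (hits Z \<union> ?V k)"
    by (intro up_closed_Un up_closed_hits) (auto simp: up_closed_def trans_le_add1)
  show ?case
  proof (cases "\<forall>i\<in>T. k i = 0")
    case True
    then show ?thesis by (intro wreg_unit U) simp
  next
    case False
    then obtain i where i: "i \<in> T" "k i > 0" by auto
    then obtain x where x: "x \<in> A i" "x \<notin> Z" using less.prems by blast
    show ?thesis
    proof (rule wreg_poly_supported_extension[OF U, of x])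
      have "x \<in> A j \<longleftrightarrow> j = i" if "j \<in> T" for j
        using disj[of x j i] that i x by blast
      then have "{m. chi {x} + m \<in> hits Z \<union> ?V k} = hits Z \<union> ?V (k(i := k i - 1))"
        using x i by (auto simp: keys_nat_add split: if_splits)
      moreover have "(\<Sum>j\<in>T. (k(i := k i - 1)) j) < (\<Sum>j\<in>T. k j)"
        using assms(1) i by (intro sum_strict_mono_ex1) auto
      ultimately show "wreg (poly_supported {m. chi {x} + m \<in> hits Z \<union> ?V k}) (esyms s :: ('n, 'k) mpoly list)"
        using less by simp
      show "wreg (poly_supported ({m. x \<in> keys m} \<union> (hits Z \<union> ?V k))) (esyms s :: ('n, 'k) mpoly list)"
      proof (cases "A i \<subseteq> insert x Z")
        case True
        \<comment> \<open>\<open>x\<close> is the last free variable of \<open>A i\<close>. As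
          \<open>k i\<close> is positive, killing it absorbs the whole product, and the other
          \<open>card T - 1\<close> sets still supply one free variable each.\<close>
        have "m \<in> hits (insert x Z)" if "m \<in> ?V k" for m
          using that i True deg_on_pos[of "A i" m] by fastforce
        then have "{m. x \<in> keys m} \<union> (hits Z \<union> ?V k) = hits (insert x Z)" by auto
        moreover have "s \<le> card (- insert x Z)"
        proof -
          have "card (T - {i}) \<le> card (\<Union>j\<in>T - {i}. A j - Z)"
          proof (rule card_le_card_disjoint_Union)
            show "disjoint_family_on (\<lambda>j. A j - Z) (T - {i})"
              using assms(2) unfolding disjoint_family_on_def by blast
            show "A j - Z \<noteq> {}" if "j \<in> T - {i}" for j using less.prems[of j] that by simp
          qed simp
          also have "\<dots> \<le> card (- insert x Z)"
          proof (intro card_mono finite subsetI)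
            fix y assume "y \<in> (\<Union>j\<in>T - {i}. A j - Z)"
            then obtain j where "j \<in> T" "j \<noteq> i" "y \<in> A j" "y \<notin> Z" by blast
            then show "y \<in> - insert x Z" using disj[of x j i] x i by blast
          qed
          finally show ?thesis using assms(3) i by simp
        qed
        ultimately show ?thesis by (simp only: wreg_hits_esyms)
      next
        case False
        have "{m. x \<in> keys m} \<union> (hits Z \<union> ?V k) = hits (insert x Z) \<union> ?V k" by auto
        moreover have "A j - insert x Z \<noteq> {}" if "j \<in> T" for j
        proof (cases "j = i")
          case False
          then have "x \<notin> A j" using disj[of x j i] i x that by blast
          then have "A j - insert x Z = A j - Z" by blast
          then show ?thesis using less.prems[OF that] by simp
        qed (use \<open>\<not> A i \<subseteq> insert x Z\<close> in blast)
        moreover have "card (- insert x Z) < card (- Z)" using x by (intro psubset_card_mono) auto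
        ultimately show ?thesis using less.hyps[of k "insert x Z"] by simp
      qed
    qed
  qed
qed

section \<open>Matroidal ideals\<close>

lemma mon_times_cancel: "mon a * p = mon a * q \<Longrightarrow> p = q"
  by (rule poly_mapping_eqI) (metis lookup_mon_times)

lemma Var_dvd_mon: "Var i dvd (mon m :: ('n::finite, 'k::field) mpoly) \<longleftrightarrow> i \<in> keys m"
proof
  assume "Var i dvd (mon m :: ('n, 'k) mpoly)"
  then obtain p :: "('n, 'k) mpoly" where "mon m = mon (chi {i}) * p" by (auto simp: Var_eq)
  then have "{m} = (+) (chi {i}) ` keys p" by (metis keys_mon keys_mon_times)
  then obtain c where "m = chi {i} + c" by blast
  then show "i \<in> keys m" by (simp add: keys_nat_add)
next
  assume "i \<in> keys m"
  then obtain c where "m = chi {i} + c" using chi_add_iff[of m "{i}"] by auto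
  then show "Var i dvd (mon m :: ('n, 'k) mpoly)" by (simp add: Var_eq flip: mon_mult)
qed

lemma squarefree_mon:
  assumes "squarefree (mon m :: ('n::finite, 'k::field) mpoly)"
  shows "m = chi (keys m)"
proof (rule poly_mapping_eqI, rule ccontr)
  fix v assume "lookup m v \<noteq> lookup (chi (keys m)) v"
  then have v: "v \<in> keys m" "lookup m v \<noteq> 1"
    by (cases "lookup m v = 0"; simp add: in_keys_iff)+
  then obtain c where c: "m = chi {v} + c" using chi_add_iff[of m "{v}"] by auto
  then have "v \<in> keys c" using v(2) by (auto simp: in_keys_iff lookup_add)
  then obtain e where "c = chi {v} + e" using chi_add_iff[of c "{v}"] by auto
  then have "(mon m :: ('n, 'k) mpoly) = Var v ^ 2 * mon e"
    using c by (simp add: Var_eq power2_eq_square mon_mult add.assoc)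
  then have "Var v dvd (1 :: ('n, 'k) mpoly)" using assms unfolding squarefree_def by (metis dvd_triv_left)
  then show False by (simp add: Var_dvd_mon flip: mon_zero)
qed

lemma matroidal_imp_matroid_bases:
  fixes I :: "('n::finite, 'k::field) mpoly set"
  assumes "matroidal I" "generated_in_degree I d"
  obtains \<B> where "matroid_bases d \<B>" "min_gens I = (\<lambda>B. mon (chi B)) ` \<B>"
    "I = ideal.span (mon ` chi ` \<B>)"
proof
  let ?B = "{B. mon (chi B) \<in> min_gens I}"
  have min: "minimal_monomial_generators I (min_gens I)"
    using assms(1) minimal_monomial_generators_min_gens unfolding matroidal_def by blast
  have "\<exists>B. u = mon (chi B)" if u: "u \<in> min_gens I" for u
  proof -
    obtain m where m: "u = mon m"
      using min u by (auto simp: minimal_monomial_generators_def)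
    moreover have "squarefree u" using assms(1) u by (simp add: matroidal_def)
    ultimately show ?thesis using squarefree_mon by metis
  qed
  then show gens: "min_gens I = (\<lambda>B. mon (chi B)) ` ?B"
    by (intro equalityI subsetI) (metis (mono_tags, lifting) image_eqI mem_Collect_eq, auto)
  show span: "I = ideal.span (mon ` chi ` ?B)"
    using min gens unfolding minimal_monomial_generators_def image_image by simp
  show "matroid_bases d ?B" unfolding matroid_bases_def
  proof (intro conjI ballI)
    show "?B \<noteq> {}" using span assms(1) unfolding matroidal_def by auto
    fix B assume B: "B \<in> ?B"
    then have "mon (chi B) \<in> (mon ` {m. exp_degree m = d} :: ('n, 'k) mpoly set)"
      using assms(2) unfolding generated_in_degree_def by blast
    then show "card B = d" by (auto simp: mon_inject exp_degree_chi)
    fix B' i assume B': "B' \<in> ?B" "i \<in> B - B'"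
    then have "Var i dvd (mon (chi B) :: ('n, 'k) mpoly)" "\<not> Var i dvd (mon (chi B') :: ('n, 'k) mpoly)"
      by (simp_all add: Var_dvd_mon)
    then obtain j w where j: "Var j dvd (mon (chi B') :: ('n, 'k) mpoly)" "\<not> Var j dvd (mon (chi B) :: ('n, 'k) mpoly)"
      and w: "mon (chi B) = Var i * w" "w * Var j \<in> min_gens I"
      using assms(1) B B' unfolding matroidal_def by blast
    have jB: "j \<in> B'" "j \<notin> B" using j by (simp_all add: Var_dvd_mon)
    have "chi B = chi {i} + chi (B - {i})" using B' by (intro poly_mapping_eqI) (auto simp: lookup_add)
    then have "mon (chi {i}) * mon (chi (B - {i})) = mon (chi {i}) * w"
      using w(1) by (simp add: Var_eq mon_mult)
    then have "w = mon (chi (B - {i}))" using mon_times_cancel by metis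
    moreover have "chi (B - {i}) + chi {j} = chi (insert j (B - {i}))"
      using jB by (intro poly_mapping_eqI) (auto simp: lookup_add)
    ultimately have "insert j (B - {i}) \<in> ?B" using w(2) by (simp add: Var_eq mon_mult)
    then show "\<exists>j\<in>B' - B. insert j (B - {i}) \<in> ?B" using jB by blast
  qed
qed

lemma up_closure_chi: "up_closure (chi ` \<B>) = (\<Union>B\<in>\<B>. covers B)"
  by (auto simp: up_closure_def chi_add_iff)

section \<open>Products of primes in disjoint sets of variables\<close>

lemma transversal_of_disjoint:
  fixes A :: "'i \<Rightarrow> 'n::finite set"
  assumes "disjoint_family_on A T" "\<And>i. i \<in> T \<Longrightarrow> keys m \<inter> A i \<noteq> {}"
  obtains v where "\<And>i. i \<in> T \<Longrightarrow> v i \<in> keys m" "\<And>i j. i \<in> T \<Longrightarrow> j \<in> T \<Longrightarrow> v j \<in> A i \<longleftrightarrow> j = i"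
proof -
  have "\<forall>i\<in>T. \<exists>x. x \<in> keys m \<inter> A i" using assms(2) by blast
  from bchoice[OF this] obtain v where v: "\<forall>i\<in>T. v i \<in> keys m \<inter> A i" ..
  have "v j \<in> A i \<longleftrightarrow> j = i" if "i \<in> T" "j \<in> T" for i j
    using that v assms(1) unfolding disjoint_family_on_def by (metis IntD2 disjoint_iff)
  then show ?thesis using that v by blast
qed

lemma prod_monomial_primes:
  fixes A :: "'i \<Rightarrow> 'n::finite set"
  assumes "finite T" "disjoint_family_on A T"
  shows "prod_ideals (\<lambda>i. monomial_prime (A i)) T =
    (poly_supported {m. \<forall>i\<in>T. keys m \<inter> A i \<noteq> {}} :: ('n, 'k::field) mpoly set)"
proof -
  let ?G = "\<lambda>i. (\<lambda>v. chi {v}) ` A i"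
  have "monomial_prime (A i) = (ideal.span (mon ` ?G i) :: ('n, 'k) mpoly set)" for i
    by (simp add: monomial_prime_def Var_eq image_image)
  then have "prod_ideals (\<lambda>i. monomial_prime (A i)) T =
      (poly_supported (up_closure {\<Sum>i\<in>T. g i | g. \<forall>i\<in>T. g i \<in> ?G i}) :: ('n, 'k) mpoly set)"
    by (simp only: prod_ideals_span_mon[OF assms(1)] flip: span_mon)
  also have "up_closure {\<Sum>i\<in>T. g i | g. \<forall>i\<in>T. g i \<in> ?G i} = {m. \<forall>i\<in>T. keys m \<inter> A i \<noteq> {}}"
  proof (intro equalityI subsetI)
    fix m assume "m \<in> up_closure {\<Sum>i\<in>T. g i | g. \<forall>i\<in>T. g i \<in> ?G i}"
    then obtain g c where g: "m = (\<Sum>i\<in>T. g i) + c" "\<forall>i\<in>T. g i \<in> ?G i"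
      unfolding up_closure_def by blast
    have "keys m \<inter> A i \<noteq> {}" if i: "i \<in> T" for i
    proof -
      obtain v where v: "v \<in> A i" "g i = chi {v}" using g(2) i by blast
      have "m = chi {v} + ((\<Sum>j\<in>T - {i}. g j) + c)"
        using g(1) sum.remove[OF assms(1) i, of g] v(2) by (simp add: add.assoc)
      then have "v \<in> keys m" by (simp add: keys_nat_add)
      then show ?thesis using v by blast
    qed
    then show "m \<in> {m. \<forall>i\<in>T. keys m \<inter> A i \<noteq> {}}" by blast
  next
    fix m :: "'n \<Rightarrow>\<^sub>0 nat" assume "m \<in> {m. \<forall>i\<in>T. keys m \<inter> A i \<noteq> {}}"
    then obtain v where v: "\<And>i. i \<in> T \<Longrightarrow> v i \<in> keys m"
        "\<And>i j. i \<in> T \<Longrightarrow> j \<in> T \<Longrightarrow> v j \<in> A i \<longleftrightarrow> j = i"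
      using transversal_of_disjoint[OF assms(2), of m] by blast
    have "inj_on v T" using v(2) by (metis inj_onI)
    then have "chi (v ` T) = (\<Sum>i\<in>T. chi {v i})"
      by (simp add: chi_eq_sum[of "v ` T"] sum.reindex)
    moreover obtain c where "m = chi (v ` T) + c" using chi_add_iff[of m "v ` T"] v(1) by blast
    moreover have "(\<Sum>i\<in>T. chi {v i}) \<in> {\<Sum>i\<in>T. g i | g. \<forall>i\<in>T. g i \<in> ?G i}"
      using v(2) by (intro CollectI exI[of _ "\<lambda>i. chi {v i}"]) auto
    ultimately show "m \<in> up_closure {\<Sum>i\<in>T. g i | g. \<forall>i\<in>T. g i \<in> ?G i}"
      unfolding up_closure_def by auto
  qed
  finally show ?thesis .
qed

text \<open>A monomial of degree at least \<open>Suc k\<close> on every \<open>A i\<close> is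
  divisible by a transversal, and dividing by it costs exactly one degree on each set.\<close>

lemma up_closure_nsum_deg_on:
  fixes A :: "'i \<Rightarrow> 'n::finite set"
  assumes "disjoint_family_on A T"
  shows "up_closure (nsum {m. \<forall>i\<in>T. 1 \<le> deg_on (A i) m} k) = {m. \<forall>i\<in>T. k \<le> deg_on (A i) m}"
    (is "up_closure (nsum ?V k) = _")
proof (intro equalityI subsetI)
  have ge: "\<forall>i\<in>T. k \<le> deg_on (A i) w" if "w \<in> nsum ?V k" for w
    using that
  proof (induction k arbitrary: w)
    case (Suc k)
    then obtain g x where x: "w = g + x" "g \<in> ?V" "x \<in> nsum ?V k" by auto
    show ?case
    proof
      fix i assume "i \<in> T"
      then have "1 \<le> deg_on (A i) g" "k \<le> deg_on (A i) x" using x Suc.IH by blast+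
      then show "Suc k \<le> deg_on (A i) w" by (simp add: x(1))
    qed
  qed simp
  fix m assume "m \<in> up_closure (nsum ?V k)"
  then obtain w c where "w \<in> nsum ?V k" "m = w + c" unfolding up_closure_def by blast
  then show "m \<in> {m. \<forall>i\<in>T. k \<le> deg_on (A i) m}" using ge[of w] by (simp add: trans_le_add1)
next
  fix m assume "m \<in> {m. \<forall>i\<in>T. k \<le> deg_on (A i) m}"
  then have "\<exists>w\<in>nsum ?V k. \<exists>c. m = w + c"
  proof (induction k arbitrary: m)
    case (Suc k)
    have "keys m \<inter> A i \<noteq> {}" if "i \<in> T" for i
      using Suc.prems that deg_on_pos[of "A i" m] by fastforce
    then obtain v where v: "\<And>i. i \<in> T \<Longrightarrow> v i \<in> keys m"
        "\<And>i j. i \<in> T \<Longrightarrow> j \<in> T \<Longrightarrow> v j \<in> A i \<longleftrightarrow> j = i"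
      using transversal_of_disjoint[OF assms, of m] by blast
    obtain m' where m': "m = chi (v ` T) + m'" using chi_add_iff[of m "v ` T"] v(1) by blast
    have deg: "deg_on (A i) (chi (v ` T)) = 1" if "i \<in> T" for i
    proof -
      have "A i \<inter> v ` T = {v i}" using that v(2) by auto
      then show ?thesis by simp
    qed
    then have "m' \<in> {m. \<forall>i\<in>T. k \<le> deg_on (A i) m}" using Suc.prems m' by simp
    then obtain w c where w: "w \<in> nsum ?V k" "m' = w + c" using Suc.IH by blast
    have "chi (v ` T) \<in> ?V" using deg by simp
    then have "chi (v ` T) + w \<in> nsum ?V (Suc k)" using w(1) unfolding nsum.simps by blast
    moreover have "m = (chi (v ` T) + w) + c" using m' w(2) by (simp add: add.assoc)
    ultimately show ?case by blast
  qed simp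
  then show "m \<in> up_closure (nsum ?V k)" unfolding up_closure_def by blast
qed

lemma deg_on_sum: "deg_on A (\<Sum>i\<in>T. f i) = (\<Sum>i\<in>T. deg_on A (f i))"
  by (induction T rule: infinite_finite_induct) simp_all

lemma deg_on_single: "deg_on A (Poly_Mapping.single v e) = (if v \<in> A then e else 0)"
  by (simp add: deg_on_def lookup_single when_def)

lemma depth_quot_disjoint_product:
  fixes A :: "'i \<Rightarrow> 'n::finite set"
  assumes "finite T" "T \<noteq> {}" "disjoint_family_on A T" "(\<Union>i\<in>T. A i) = UNIV"
    and nonempty: "\<And>i. i \<in> T \<Longrightarrow> A i \<noteq> {}" and "k \<ge> 1"
  shows "depth_quot (poly_supported {m. \<forall>i\<in>T. k \<le> deg_on (A i) m} :: ('n, 'k::field) mpoly set) =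
    enat (card T - 1)" (is "depth_quot ?J = _")
proof (rule antisym)
  have U: "up_closed {m. \<forall>i\<in>T. k \<le> deg_on (A i) m}"
    by (auto simp: up_closed_def intro: trans_le_add1)
  have "0 \<notin> {m. \<forall>i\<in>T. k \<le> deg_on (A i) m}" using assms(2,6) by auto
  then have "?J \<subseteq> max_graded_ideal"
    unfolding max_graded_ideal_eq poly_supported_def by (intro Collect_mono) (auto simp: subset_iff)
  moreover have "card T \<noteq> 0" using assms(1,2) by simp
  then have "wreg ?J (esyms (card T - 1))"
    using wreg_disjoint_product[OF assms(1,3), of "card T - 1" "{}" "\<lambda>_. k"] nonempty by simp
  ultimately show "enat (card T - 1) \<le> depth_quot ?J"
    using depth_quot_ge[OF subspace_poly_supported[OF U] _ esyms_subset] by fastforce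
next
  have "\<forall>v. \<exists>i. i \<in> T \<and> v \<in> A i" using assms(4) by blast
  then obtain col where col: "\<And>v. col v \<in> T" "\<And>v. v \<in> A (col v)" by metis
  have col_eq: "col v = i" if "v \<in> A i" "i \<in> T" for v i
    using that col assms(3) unfolding disjoint_family_on_def by (metis disjoint_iff)
  have range: "range col = T" using col(1) col_eq nonempty by fast
  have "\<forall>i\<in>T. \<exists>x. x \<in> A i" using nonempty by blast
  from bchoice[OF this] obtain a where a: "\<And>i. i \<in> T \<Longrightarrow> a i \<in> A i" by blast
  have a_iff: "a j \<in> A i \<longleftrightarrow> j = i" if "i \<in> T" "j \<in> T" for i j
    using that a col_eq by metis
  \<comment> \<open>\<open>u\<close> has degree k - 1 on each set, one short of the requirement, so
    a further factor is good enough exactly if it meets all the sets.\<close>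
  define u where "u = (\<Sum>i\<in>T. Poly_Mapping.single (a i) (k - 1))"
  have deg_u: "deg_on (A i) u = k - 1" if "i \<in> T" for i
  proof -
    have "deg_on (A i) u = (\<Sum>j\<in>T. if j = i then k - 1 else 0)"
      unfolding u_def deg_on_sum deg_on_single using a_iff that by (intro sum.cong) auto
    then show ?thesis using that assms(1) by simp
  qed
  have "u + m \<in> {m. \<forall>i\<in>T. k \<le> deg_on (A i) m} \<longleftrightarrow> range col \<subseteq> col ` keys m" for m
  proof -
    have "u + m \<in> {m. \<forall>i\<in>T. k \<le> deg_on (A i) m} \<longleftrightarrow> (\<forall>i\<in>T. deg_on (A i) m > 0)"
      using deg_u assms(6) by auto
    also have "\<dots> \<longleftrightarrow> (\<forall>i\<in>T. i \<in> col ` keys m)"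
    proof (intro ball_cong refl)
      fix i assume i: "i \<in> T"
      have "v \<in> A i \<longleftrightarrow> col v = i" for v using i col(2)[of v] col_eq[of v i] by blast
      then show "deg_on (A i) m > 0 \<longleftrightarrow> i \<in> col ` keys m" unfolding deg_on_pos by auto
    qed
    finally show ?thesis unfolding range by blast
  qed
  moreover have "up_closed {m. \<forall>i\<in>T. k \<le> deg_on (A i) m}"
    by (auto simp: up_closed_def intro: trans_le_add1)
  ultimately show "depth_quot ?J \<le> enat (card T - 1)"
    using depth_quot_le_colors[of _ u col] unfolding range by blast
qed

section \<open>Components of a matroid\<close>

text \<open>
  Two elements \<open>i\<close> and \<open>j\<close> are linked if the difference of their unit vectors lies in the lattice generated by
  the differences of bases. For the bases of a matroid, the classes are the connected components.
\<close>

definition linked :: "'n::finite set set \<Rightarrow> 'n \<Rightarrow> 'n \<Rightarrow> bool" where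
  "linked \<B> i j \<longleftrightarrow> (\<exists>k. \<exists>w\<in>nsum (chi ` \<B>) k. \<exists>w'\<in>nsum (chi ` \<B>) k. w + chi {i} = w' + chi {j})"

lemma linked_refl: "linked \<B> i i"
  unfolding linked_def by (rule exI[of _ 0]) simp

lemma linked_sym: "linked \<B> i j \<Longrightarrow> linked \<B> j i"
  unfolding linked_def by metis

lemma linked_trans:
  assumes "linked \<B> i j" "linked \<B> j l"
  shows "linked \<B> i l"
proof -
  obtain k1 w1 w1' where 1: "w1 \<in> nsum (chi ` \<B>) k1" "w1' \<in> nsum (chi ` \<B>) k1" "w1 + chi {i} = w1' + chi {j}"
    using assms(1) unfolding linked_def by blast
  obtain k2 w2 w2' where 2: "w2 \<in> nsum (chi ` \<B>) k2" "w2' \<in> nsum (chi ` \<B>) k2" "w2 + chi {j} = w2' + chi {l}"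
    using assms(2) unfolding linked_def by blast
  have "(w1 + w2) + chi {i} = (w1 + chi {i}) + w2" by (simp add: ac_simps)
  also have "\<dots> = w1' + (w2 + chi {j})" unfolding 1(3) by (simp add: ac_simps)
  also have "\<dots> = (w1' + w2') + chi {l}" unfolding 2(3) by (simp add: ac_simps)
  finally show ?thesis unfolding linked_def using 1 2 nsum_add by metis
qed

definition component :: "'n::finite set set \<Rightarrow> 'n \<Rightarrow> 'n set" where
  "component \<B> i = {j. linked \<B> i j}"

lemma component_eq_iff: "component \<B> i = component \<B> j \<longleftrightarrow> linked \<B> i j"
  unfolding component_def using linked_refl linked_sym linked_trans by blast

lemma chi_insert: "v \<notin> B \<Longrightarrow> chi (insert v B) = chi {v} + chi B"
  by (rule poly_mapping_eqI) (auto simp: lookup_add)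

lemma linked_exchange:
  assumes "B \<in> \<B>" "insert j (B - {i}) \<in> \<B>" "i \<in> B" "j \<notin> B"
  shows "linked \<B> i j"
proof -
  have "chi (insert j (B - {i})) = chi {j} + chi (B - {i})" "chi B = chi {i} + chi (B - {i})"
    using chi_insert[of j "B - {i}"] chi_insert[of i "B - {i}"] assms by (simp_all add: insert_absorb)
  then have "chi (insert j (B - {i})) + chi {i} = chi B + chi {j}" by (simp add: ac_simps)
  then show ?thesis using assms nsum_1[of _ "chi ` \<B>"] unfolding linked_def by blast
qed

text \<open>Any basis reaches any other by exchanges, and each exchange swaps two linked elements,
  hence stays within a component.\<close>

lemma card_component_Int_basis:
  assumes M: "matroid_bases r \<B>" and "B \<in> \<B>" "B' \<in> \<B>"
  shows "card ({v. component \<B> v = c} \<inter> B) = card ({v. component \<B> v = c} \<inter> B')"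
  using assms(2)
proof (induction "card (B - B')" arbitrary: B rule: less_induct)
  case less
  let ?A = "{v. component \<B> v = c}"
  show ?case
  proof (cases "B \<subseteq> B'")
    case True
    then have "B = B'"
      using M less.prems assms(3) unfolding matroid_bases_def by (metis card_subset_eq finite)
    then show ?thesis by simp
  next
    case False
    then obtain i where i: "i \<in> B" "i \<notin> B'" by blast
    then obtain j where j: "j \<in> B'" "j \<notin> B" "insert j (B - {i}) \<in> \<B>"
      using matroid_bases_exchange[OF M less.prems assms(3)] by blast
    have "insert j (B - {i}) - B' \<subset> B - B'" using i j by auto
    then have "card (insert j (B - {i}) - B') < card (B - B')" by (simp add: psubset_card_mono)
    then have IH: "card (?A \<inter> insert j (B - {i})) = card (?A \<inter> B')" using less.hyps j(3) by blast
    have "component \<B> i = component \<B> j"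
      using linked_exchange[OF less.prems j(3) i(1) j(2)] component_eq_iff by blast
    then have "deg_on ?A (chi {i}) = deg_on ?A (chi {j})" by (simp add: Int_insert_right)
    moreover have "chi B = chi {i} + chi (B - {i})" "chi (insert j (B - {i})) = chi {j} + chi (B - {i})"
      using chi_insert[of i "B - {i}"] chi_insert[of j "B - {i}"] i j by (simp_all add: insert_absorb)
    ultimately have "deg_on ?A (chi B) = deg_on ?A (chi (insert j (B - {i})))" by simp
    then show ?thesis using IH by simp
  qed
qed

lemma component_meets_basis:
  assumes M: "matroid_bases r \<B>" and "\<Union>\<B> = UNIV" "B \<in> \<B>"
  obtains b where "b \<in> B" "component \<B> b = component \<B> v"
proof -
  obtain B' where "B' \<in> \<B>" "v \<in> B'" using assms(2) by blast
  moreover from this have "{w. component \<B> w = component \<B> v} \<inter> B' \<noteq> {}" by blast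
  ultimately have "card ({w. component \<B> w = component \<B> v} \<inter> B) \<noteq> 0"
    using card_component_Int_basis[OF M assms(3)] by (metis card_0_eq finite)
  then have "{w. component \<B> w = component \<B> v} \<inter> B \<noteq> {}" by (metis card.empty)
  then show ?thesis using that by blast
qed

text \<open>
  The exponent \<open>u\<close> below is a sum of bases with one element of each component removed; the bases are chosen
  such that any other element of the component can take the place of the removed one.
\<close>

lemma ex_depth_quot_power_le:
  fixes \<B> :: "'n::finite set set"
  assumes M: "matroid_bases r \<B>" and "\<Union>\<B> = UNIV"
  obtains k where "k \<ge> 1"
    "depth_quot (power_ideal (ideal.span (mon ` chi ` \<B>)) k :: ('n, 'k::field) mpoly set) \<le>
      card (range (component \<B>)) - 1"
proof -
  let ?G = "chi ` \<B>" and ?col = "component \<B>"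
  obtain B0 where B0: "B0 \<in> \<B>" using M unfolding matroid_bases_def by blast
  have "\<forall>c\<in>range ?col. \<exists>b. b \<in> B0 \<and> ?col b = c"
    using component_meets_basis[OF M assms(2) B0] by (metis rangeE)
  then obtain \<rho> where \<rho>: "\<And>c. c \<in> range ?col \<Longrightarrow> \<rho> c \<in> B0" "\<And>c. c \<in> range ?col \<Longrightarrow> ?col (\<rho> c) = c"
    by metis
  have "\<forall>v. \<exists>k w w'. w \<in> nsum ?G k \<and> w' \<in> nsum ?G k \<and> w + chi {v} = w' + chi {\<rho> (?col v)}"
  proof
    fix v
    have "linked \<B> v (\<rho> (?col v))" using \<rho>(2)[of "?col v"] component_eq_iff[of \<B> v "\<rho> (?col v)"] by (metis rangeI)
    then show "\<exists>k w w'. w \<in> nsum ?G k \<and> w' \<in> nsum ?G k \<and> w + chi {v} = w' + chi {\<rho> (?col v)}"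
      unfolding linked_def by blast
  qed
  then obtain \<kappa> w w' where w: "\<And>v. w v \<in> nsum ?G (\<kappa> v)" "\<And>v. w' v \<in> nsum ?G (\<kappa> v)"
      "\<And>v. w v + chi {v} = w' v + chi {\<rho> (?col v)}"
    by metis
  let ?R = "\<rho> ` range ?col"
  define u where "u = chi (B0 - ?R) + (\<Sum>v\<in>UNIV. w v)"
  define k where "k = 1 + (\<Sum>v\<in>UNIV. \<kappa> v)"
  have inj: "inj_on \<rho> (range ?col)" using \<rho>(2) by (metis inj_on_inverseI)
  have R: "?R \<subseteq> B0" using \<rho>(1) by blast
  have "u + m \<in> up_closure (nsum ?G k) \<longleftrightarrow> range ?col \<subseteq> ?col ` keys m" for m
  proof
    assume "range ?col \<subseteq> ?col ` keys m"
    then have "\<forall>c\<in>range ?col. \<exists>v. v \<in> keys m \<and> ?col v = c" by (metis imageE subsetD)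
    then obtain \<tau> where \<tau>: "\<And>c. c \<in> range ?col \<Longrightarrow> \<tau> c \<in> keys m" "\<And>c. c \<in> range ?col \<Longrightarrow> ?col (\<tau> c) = c"
      by metis
    let ?V = "\<tau> ` range ?col"
    have inj_\<tau>: "inj_on \<tau> (range ?col)" using \<tau>(2) by (metis inj_on_inverseI)
    obtain m' where m': "m = chi ?V + m'" using chi_add_iff[of m ?V] \<tau>(1) by blast
    \<comment> \<open>At the chosen variables \<open>w'\<close> replaces \<open>w\<close>. By the
      relations this absorbs the chosen variable of each component and releases its representative
      in \<open>B0\<close>, which fills the gap left in \<open>u\<close>.\<close>
    define z where "z v = (if v \<in> ?V then w' v else w v)" for v
    have "(\<Sum>v\<in>UNIV. w v) + chi ?V = (\<Sum>v\<in>UNIV. w v + (if v \<in> ?V then chi {v} else 0))"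
      by (simp add: chi_eq_sum[of ?V] sum.distrib sum.If_cases)
    also have "\<dots> = (\<Sum>v\<in>UNIV. z v + (if v \<in> ?V then chi {\<rho> (?col v)} else 0))"
      by (intro sum.cong) (auto simp: z_def w(3))
    also have "\<dots> = (\<Sum>v\<in>UNIV. z v) + (\<Sum>v\<in>?V. chi {\<rho> (?col v)})"
      by (simp add: sum.distrib sum.If_cases)
    also have "(\<Sum>v\<in>?V. chi {\<rho> (?col v)}) = (\<Sum>c\<in>range ?col. chi {\<rho> c})"
      unfolding sum.reindex[OF inj_\<tau>] by (intro sum.cong) (simp_all add: \<tau>(2))
    also have "\<dots> = chi ?R" by (simp add: chi_eq_sum[of ?R] sum.reindex[OF inj])
    finally have swap: "(\<Sum>v\<in>UNIV. w v) + chi ?V = (\<Sum>v\<in>UNIV. z v) + chi ?R" .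
    have "u + m = chi (B0 - ?R) + ((\<Sum>v\<in>UNIV. w v) + chi ?V) + m'"
      unfolding u_def m' by (simp only: add.assoc)
    also have "\<dots> = (chi (B0 - ?R) + chi ?R + (\<Sum>v\<in>UNIV. z v)) + m'"
      unfolding swap by (simp only: ac_simps)
    also have "chi (B0 - ?R) + chi ?R = chi B0"
      using R by (intro poly_mapping_eqI) (auto simp: lookup_add)
    finally have "u + m = (chi B0 + (\<Sum>v\<in>UNIV. z v)) + m'" .
    moreover have "(\<Sum>v\<in>UNIV. z v) \<in> nsum ?G (\<Sum>v\<in>UNIV. \<kappa> v)"
      by (rule nsum_sum) (simp_all add: z_def w)
    then have "chi B0 + (\<Sum>v\<in>UNIV. z v) \<in> nsum ?G k"
      unfolding k_def using B0 by (intro nsum_add nsum_1) auto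
    ultimately show "u + m \<in> up_closure (nsum ?G k)" unfolding up_closure_def by blast
  next
    assume "u + m \<in> up_closure (nsum ?G k)"
    then obtain x c where x: "u + m = x + c" "x \<in> nsum ?G k" unfolding up_closure_def by blast
    show "range ?col \<subseteq> ?col ` keys m"
    proof
      fix a assume a: "a \<in> range ?col"
      let ?A = "{v. ?col v = a}"
      let ?\<delta> = "card (?A \<inter> B0)"
      \<comment> \<open>All sums of l bases have the same degree on a component. For
        \<open>u\<close> the degree is one less than for a sum of k bases, as the representative is
        missing, so \<open>m\<close> must contribute on every component.\<close>
      have deg: "deg_on ?A y = l * ?\<delta>" if "y \<in> nsum ?G l" for y l
        using that by (rule deg_on_nsum[rotated]) (auto intro: card_component_Int_basis[OF M _ B0])
      have "?A \<inter> B0 = insert (\<rho> a) (?A \<inter> (B0 - ?R))" using \<rho> a by auto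
      moreover have "\<rho> a \<notin> ?A \<inter> (B0 - ?R)" using a by blast
      ultimately have "?\<delta> = Suc (card (?A \<inter> (B0 - ?R)))" by (metis card_insert_disjoint finite)
      moreover have "deg_on ?A u = card (?A \<inter> (B0 - ?R)) + (\<Sum>v\<in>UNIV. \<kappa> v) * ?\<delta>"
        unfolding u_def by (simp add: deg_on_sum deg[OF w(1)] sum_distrib_right)
      moreover have "deg_on ?A u + deg_on ?A m = k * ?\<delta> + deg_on ?A c"
        using arg_cong[OF x(1), of "deg_on ?A"] deg[OF x(2)] by simp
      ultimately have "deg_on ?A m > 0" unfolding k_def by (simp add: algebra_simps)
      then show "a \<in> ?col ` keys m" unfolding deg_on_pos by blast
    qed
  qed
  then have "depth_quot (poly_supported (up_closure (nsum ?G k)) :: ('n, 'k) mpoly set) \<le> card (range ?col) - 1"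
    by (rule depth_quot_le_colors[OF up_closed_up_closure])
  moreover have "k \<ge> 1" by (simp add: k_def)
  ultimately show ?thesis
    using that[of k] unfolding power_ideal_span_mon span_mon[of "nsum ?G k"] by blast
qed

text \<open>Each basis meets every component, so with r components it contains exactly one element
  of each. Conversely a transversal is compared with a basis closest to it: an exchange has to
  refill the component that it vacates, and this can be steered towards the transversal.\<close>

lemma bases_of_many_components:
  fixes \<B> :: "'n::finite set set"
  assumes M: "matroid_bases r \<B>" and "\<Union>\<B> = UNIV" "r \<le> card (range (component \<B>))"
  shows "card (range (component \<B>)) = r"
    and "(\<Union>B\<in>\<B>. covers B) = {m :: 'n \<Rightarrow>\<^sub>0 nat. range (component \<B>) \<subseteq> component \<B> ` keys m}"
proof -
  let ?col = "component \<B>"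
  have surj: "?col ` B = range ?col" if "B \<in> \<B>" for B
    using component_meets_basis[OF M assms(2) that]
    by (metis image_eqI image_mono image_subset_iff rangeE subsetI subset_UNIV subset_antisym)
  have card: "card B = r" if "B \<in> \<B>" for B using M that unfolding matroid_bases_def by blast
  obtain B0 where B0: "B0 \<in> \<B>" using M unfolding matroid_bases_def by blast
  have "card (range ?col) \<le> r" using surj[OF B0] card[OF B0] card_image_le[of B0 ?col] by simp
  then show r: "card (range ?col) = r" using assms(3) by simp
  have inj: "inj_on ?col B" if "B \<in> \<B>" for B
    using surj[OF that] card[OF that] r by (intro eq_card_imp_inj_on) simp_all
  have transversal: "T \<in> \<B>" if T: "inj_on ?col T" "?col ` T = range ?col" for T
  proof -
    obtain B where B: "B \<in> \<B>" and min: "\<And>B'. B' \<in> \<B> \<Longrightarrow> card (T - B) \<le> card (T - B')"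
      using ex_has_least_nat[of "\<lambda>B. B \<in> \<B>" B0 "\<lambda>B. card (T - B)"] B0 by blast
    have "T \<subseteq> B"
    proof (rule subsetI, rule ccontr)
      fix i assume i: "i \<in> T" "i \<notin> B"
      obtain B' where B': "B' \<in> \<B>" "i \<in> B'" using assms(2) by blast
      obtain b where b: "b \<in> B" "?col b = ?col i" using component_meets_basis[OF M assms(2) B] by blast
      have "b \<notin> B'" using inj_onD[OF inj[OF B'(1)] b(2)] B'(2) b(1) i(2) by blast
      then obtain j where j: "j \<in> B'" "j \<notin> B" "insert j (B - {b}) \<in> \<B>"
        using matroid_bases_exchange[OF M B B'(1) b(1)] by blast
      \<comment> \<open>The new basis must meet the component of \<open>b\<close>, and only
        \<open>j\<close> can do so. Since \<open>B'\<close> has no element but \<open>i\<close> in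
        that component, \<open>j = i\<close>, and the exchange has moved \<open>B\<close> closer to
        \<open>T\<close>.\<close>
      obtain b' where b': "b' \<in> insert j (B - {b})" "?col b' = ?col b"
        using component_meets_basis[OF M assms(2) j(3)] by blast
      have "b' = j" using b' inj_onD[OF inj[OF B], of b' b] b(1) by blast
      then have "j = i" using inj_onD[OF inj[OF B'(1)], of j i] b' b(2) j(1) B'(2) by simp
      have "b \<notin> T" using inj_onD[OF T(1) b(2)] i b(1) by blast
      then have "T - insert j (B - {b}) \<subset> T - B" using i \<open>j = i\<close> by auto
      then have "card (T - insert j (B - {b})) < card (T - B)" by (simp add: psubset_card_mono)
      then show False using min[OF j(3)] by simp
    qed
    moreover have "card T = r" using T r card_image by metis
    ultimately show ?thesis using card_subset_eq[of B T] card[OF B] B by simp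
  qed
  show "(\<Union>B\<in>\<B>. covers B) = {m. range ?col \<subseteq> ?col ` keys m}"
  proof (intro equalityI subsetI)
    fix m assume "m \<in> (\<Union>B\<in>\<B>. covers B)"
    then obtain B where B: "B \<in> \<B>" "B \<subseteq> keys m" by blast
    show "m \<in> {m. range ?col \<subseteq> ?col ` keys m}"
      using image_mono[OF B(2), of ?col] surj[OF B(1)] by simp
  next
    fix m :: "'n \<Rightarrow>\<^sub>0 nat" assume "m \<in> {m. range ?col \<subseteq> ?col ` keys m}"
    then obtain T where T: "T \<subseteq> keys m" "inj_on ?col T" "?col ` T = range ?col"
      using subset_image_inj[of "range ?col" ?col "keys m"] by auto
    then show "m \<in> (\<Union>B\<in>\<B>. covers B)" using transversal[OF T(2,3)] T(1) by blast
  qed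
qed

section \<open>The two implications\<close>

lemma poly_supported_inject: "(poly_supported U :: ('n::finite, 'k::field) mpoly set) = poly_supported V \<longleftrightarrow> U = V"
proof
  assume eq: "(poly_supported U :: ('n, 'k) mpoly set) = poly_supported V"
  show "U = V" using arg_cong[OF eq, of "\<lambda>J. {m. mon m \<in> J}"] by simp
qed simp

lemma depth_quot_matroid_ge:
  fixes \<B> :: "'n::finite set set"
  assumes M: "matroid_bases d \<B>" and "d \<ge> 1"
  shows "depth_quot (poly_supported (\<Union>B\<in>\<B>. covers B) :: ('n, 'k::field) mpoly set) \<ge> d - 1"
    (is "depth_quot ?J \<ge> _")
proof -
  have "{} \<notin> \<B>" using assms unfolding matroid_bases_def by fastforce
  then have "0 \<notin> (\<Union>B\<in>\<B>. covers B)" by auto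
  then have "?J \<subseteq> max_graded_ideal"
    unfolding max_graded_ideal_eq poly_supported_def by (intro Collect_mono) (auto simp: subset_iff)
  moreover have "wreg ?J (esyms (d - 1))"
    using wreg_matroid[OF M, of UNIV "{}" "d - 1"] assms(2) by simp
  moreover have "up_closed (\<Union>B\<in>\<B>. covers B)" by (intro up_closed_UN up_closed_covers)
  ultimately show ?thesis
    using depth_quot_ge[OF subspace_poly_supported _ esyms_subset] by fastforce
qed

lemma constant_depth_function_of_product:
  fixes I :: "('n::finite, 'k::field) mpoly set"
  assumes "disjoint_family_on A T" "finite T" "T \<noteq> {}" "(\<Union>i\<in>T. A i) = UNIV"
    and "\<And>i. i \<in> T \<Longrightarrow> A i \<noteq> {}" and I: "I = poly_supported {m. \<forall>i\<in>T. keys m \<inter> A i \<noteq> {}}"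
  shows "constant_depth_function I"
proof -
  let ?V = "\<lambda>k. {m. \<forall>i\<in>T. k \<le> deg_on (A i) m}"
  have "{m. \<forall>i\<in>T. keys m \<inter> A i \<noteq> {}} = ?V 1"
    using deg_on_pos by (metis (no_types, lifting) One_nat_def Suc_le_eq)
  then have I1: "I = poly_supported (?V 1)" using I by simp
  have "up_closed (?V 1)" by (auto simp: up_closed_def intro: trans_le_add1)
  then have span: "I = ideal.span (mon ` ?V 1)" unfolding I1 by (rule poly_supported_eq_span)
  have power: "power_ideal I k = poly_supported (?V k)" for k
    by (simp only: span power_ideal_span_mon span_mon[of "nsum (?V 1) k"]
        up_closure_nsum_deg_on[OF assms(1)])
  have depth: "depth_quot (poly_supported (?V k) :: ('n, 'k) mpoly set) = enat (card T - 1)"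
    if "k \<ge> 1" for k
    using assms that by (intro depth_quot_disjoint_product) auto
  show ?thesis
    unfolding constant_depth_function_def depth_function_def I1 depth[OF order_refl]
    unfolding power[unfolded I1] by (intro allI impI depth)
qed

theorem theorem2p5:
  fixes I :: "('n::finite, 'k::field) mpoly set" and d :: nat
  assumes "matroidal I" and "generated_in_degree I d" and "d \<ge> 1"
    and "is_gcd 1 (min_gens I)" and "Supp I = range Var"
  shows "constant_depth_function I \<longleftrightarrow>
    (\<exists>A :: nat \<Rightarrow> 'n set. disjoint_family_on A {1..d} \<and>
       I = prod_ideals (\<lambda>i. monomial_prime (A i)) {1..d})"
proof -
  obtain \<B> where M: "matroid_bases d \<B>" and gens: "min_gens I = (\<lambda>B. mon (chi B)) ` \<B>"
    and span: "I = ideal.span (mon ` chi ` \<B>)"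
    using matroidal_imp_matroid_bases[OF assms(1,2)] by blast
  have I: "I = poly_supported (\<Union>B\<in>\<B>. covers B)"
    unfolding span span_mon up_closure_chi ..
  have cover: "\<Union>\<B> = UNIV"
  proof -
    have "\<exists>B\<in>\<B>. v \<in> B" for v
    proof -
      have "Var v \<in> Supp I" using assms(5) by simp
      then obtain i B where "(Var v :: ('n, 'k) mpoly) = Var i" "B \<in> \<B>"
          "Var i dvd (mon (chi B) :: ('n, 'k) mpoly)"
        unfolding Supp_def gens by blast
      moreover from this have "v \<in> B" unfolding Var_dvd_mon[symmetric] by (metis Var_dvd_mon keys_chi)
      ultimately show ?thesis by blast
    qed
    then show ?thesis by blast
  qed
  show ?thesis
  proof
    assume const: "constant_depth_function I"
    let ?C = "range (component \<B>)"
    obtain k where k: "k \<ge> 1" "depth_quot (power_ideal I k) \<le> card ?C - 1"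
      using ex_depth_quot_power_le[OF M cover] unfolding span by blast
    have "enat (d - 1) \<le> depth_quot I" unfolding I using M assms(3) by (rule depth_quot_matroid_ge)
    also have "\<dots> = depth_quot (power_ideal I k)"
      using const k(1) unfolding constant_depth_function_def depth_function_def by simp
    finally have "enat (d - 1) \<le> enat (card ?C - 1)" using k(2) by (rule order_trans)
    \<comment> \<open>Subtraction is truncated, so the 1 on the right can be cancelled only because
      there is at least one component.\<close>
    moreover have "card ?C \<noteq> 0" by simp
    ultimately have "d \<le> card ?C" by (simp del: card_0_eq)
    note C = bases_of_many_components[OF M cover this]
    obtain h where h: "bij_betw h {1..d} ?C"
      using ex_bij_betw_nat_finite_1[of ?C] C(1) by auto
    let ?A = "\<lambda>i. {v. component \<B> v = h i}"
    have disj: "disjoint_family_on ?A {1..d}"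
      using bij_betw_imp_inj_on[OF h] by (auto simp: disjoint_family_on_def dest: inj_onD)
    have "keys m \<inter> ?A i \<noteq> {} \<longleftrightarrow> h i \<in> component \<B> ` keys m" for m :: "'n \<Rightarrow>\<^sub>0 nat" and i
      by auto
    then have "{m. \<forall>i\<in>{1..d}. keys m \<inter> ?A i \<noteq> {}} =
        {m :: 'n \<Rightarrow>\<^sub>0 nat. \<forall>c\<in>h ` {1..d}. c \<in> component \<B> ` keys m}"
      by (simp only: ball_simps)
    also have "h ` {1..d} = ?C" using h by (rule bij_betw_imp_surj_on)
    finally have "{m. \<forall>i\<in>{1..d}. keys m \<inter> ?A i \<noteq> {}} = (\<Union>B\<in>\<B>. covers B)"
      unfolding C(2)[unfolded subset_eq[of "range _"]] .
    then have "I = prod_ideals (\<lambda>i. monomial_prime (?A i)) {1..d}"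
      unfolding I prod_monomial_primes[OF finite_atLeastAtMost disj] by simp
    then show "\<exists>A :: nat \<Rightarrow> 'n set. disjoint_family_on A {1..d} \<and>
        I = prod_ideals (\<lambda>i. monomial_prime (A i)) {1..d}"
      using disj by blast
  next
    assume "\<exists>A :: nat \<Rightarrow> 'n set. disjoint_family_on A {1..d} \<and>
        I = prod_ideals (\<lambda>i. monomial_prime (A i)) {1..d}"
    then obtain A :: "nat \<Rightarrow> 'n set" where A: "disjoint_family_on A {1..d}"
      and prod: "I = poly_supported {m. \<forall>i\<in>{1..d}. keys m \<inter> A i \<noteq> {}}"
      by (auto simp: prod_monomial_primes)
    have U: "(\<Union>B\<in>\<B>. covers B) = {m. \<forall>i\<in>{1..d}. keys m \<inter> A i \<noteq> {}}"
      using trans[OF I[symmetric] prod] by (simp only: poly_supported_inject)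
    \<comment> \<open>Since a basis exists, this also shows that no \<open>A i\<close> is
      empty.\<close>
    have hit: "B \<inter> A i \<noteq> {}" if "B \<in> \<B>" "i \<in> {1..d}" for B i
    proof -
      have "chi B \<in> (\<Union>B\<in>\<B>. covers B)" using that by auto
      then show ?thesis unfolding U using that(2) by simp
    qed
    \<comment> \<open>A variable outside all \<open>A i\<close> could be dropped from a basis
      through it without leaving the ideal; the smaller set would then contain a basis, although all
      bases have the same size.\<close>
    have "\<exists>i\<in>{1..d}. v \<in> A i" for v
    proof (rule ccontr)
      assume v: "\<not> (\<exists>i\<in>{1..d}. v \<in> A i)"
      obtain B where B: "B \<in> \<B>" "v \<in> B" using cover by blast
      have "(B - {v}) \<inter> A i \<noteq> {}" if "i \<in> {1..d}" for i using hit[OF B(1) that] v that by blast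
      then have "chi (B - {v}) \<in> (\<Union>B\<in>\<B>. covers B)" unfolding U by simp
      then obtain B' where B': "B' \<in> \<B>" "B' \<subseteq> B - {v}" by auto
      then have "card B' < card B" using B(2) by (intro psubset_card_mono) auto
      then show False using M B B' unfolding matroid_bases_def by simp
    qed
    moreover obtain B0 where "B0 \<in> \<B>" using M unfolding matroid_bases_def by blast
    ultimately show "constant_depth_function I"
      using hit assms(3) by (intro constant_depth_function_of_product[OF A _ _ _ _ prod]) auto
  qed
qed

end
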